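(* Let $\Omega\subset\mathbb{R}^n$ be a domain and suppose that $\lambda>0$, $C>0$ are such that any $f\in\mathrm{bmo}_\lambda(\Omega)$ is the restriction to $\Omega$ of some $F\in\mathrm{BMO}(\mathbb{R}^n)$ with $$\|F\|_{\mathrm{BMO}(\mathbb{R}^n)}\le C\|f\|_{\mathrm{bmo}_\lambda(\Omega)}.$$ Then $\Omega$ is a locally uniform domain.
   Context: A domain is a nonempty open connected set. $Q$ denotes a closed cube with sides parallel to the axes, $\ell(Q)$ its sidelength, $f_Q$ the mean of $f$ over $Q$, $|f|_Q$ the mean of $|f|$ over $Q$. $\mathrm{BMO}(\mathbb{R}^n)$ is the set of locally integrable $F$ on $\mathbb{R}^n$ with $\|F\|_{\mathrm{BMO}(\mathbb{R}^n)}:=\sup_{Q\subset\mathbb{R}^n}\frac1{|Q|}\int_Q|F(x)-F_Q|\,dx<\infty$. $\mathrm{bmo}_\lambda(\Omega)$ is the set of functions $f$ integrable on every cube $Q\subset\Omega$ with $$\|f\|_{\mathrm{bmo}_\lambda(\Omega)}:=\sup_{Q\subset\Omega,\ \ell(Q)<\lambda}\frac1{|Q|}\int_Q|f(x)-f_Q|\,dx+\sup_{Q\subset\Omega,\ \ell(Q)\ge\lambda}|f|_Q<\infty$$ (the second supremum is $0$ if $\Omega$ contains no cube of sidelength at least $\lambda$). Let $d_\Omega(z)=\mathrm{dist}(z,\partial\Omega)$ (with $d_\Omega\equiv+\infty$ if $\Omega=\mathbb{R}^n$), $s(\gamma)$ the arclength of $\gamma$, and $\gamma(p,q)$ the portion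 of $\gamma$ between two of its points $p,q$. $\Omega$ is locally uniform if there exist $a,b\ge1$ and $\delta>0$ such that for all $x,y\in\Omega$ with $|x-y|<\delta$ there is a rectifiable curve $\gamma\subset\Omega$ connecting $x$ and $y$ with $s(\gamma)\le a|x-y|$ and $\min\{s(\gamma(x,z)),s(\gamma(z,y))\}\le b\,d_\Omega(z)$ for all $z\in\gamma$. *)

theory Defs
  imports "HOL-Analysis.Analysis"
begin

definition is_domain :: "'a::topological_space set \<Rightarrow> bool" where
  "is_domain \<Omega> \<longleftrightarrow> \<Omega> \<noteq> {} \<and> open \<Omega> \<and> connected \<Omega>"

(* Closed axis-parallel cube given by its lower corner and its sidelength l;
   it is used only for l > 0. *)
definition cube :: "real ^ 'n \<Rightarrow> real \<Rightarrow> (real ^ 'n) set" where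
  "cube c l = cbox c (\<chi> i. c $ i + l)"

definition mean :: "(real ^ 'n \<Rightarrow> real) \<Rightarrow> (real ^ 'n) set \<Rightarrow> real" where
  "mean f Q = (LINT x:Q|lebesgue. f x) / measure lebesgue Q"

definition mean_osc :: "(real ^ 'n \<Rightarrow> real) \<Rightarrow> (real ^ 'n) set \<Rightarrow> real" where
  "mean_osc f Q = mean (\<lambda>x. \<bar>f x - mean f Q\<bar>) Q"

(* The norms are suprema in ennreal: they may be infinite, and the supremum of the
   empty set is 0. The sets BMO and bmo below add the integrability that makes the
   means meaningful. *)
definition BMO_norm :: "(real ^ 'n \<Rightarrow> real) \<Rightarrow> ennreal" where
  "BMO_norm F = (SUP (c, l) \<in> {(c, l). 0 < l}. ennreal (mean_osc F (cube c l)))"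

definition BMO :: "(real ^ 'n \<Rightarrow> real) set" where
  "BMO = {F. (\<forall>K. compact K \<longrightarrow> F absolutely_integrable_on K) \<and> BMO_norm F < \<infinity>}"

definition bmo_norm :: "real \<Rightarrow> (real ^ 'n) set \<Rightarrow> (real ^ 'n \<Rightarrow> real) \<Rightarrow> ennreal" where
  "bmo_norm lam \<Omega> f =
     (SUP (c, l) \<in> {(c, l). 0 < l \<and> cube c l \<subseteq> \<Omega> \<and> l < lam}. ennreal (mean_osc f (cube c l)))
   + (SUP (c, l) \<in> {(c, l). 0 < l \<and> cube c l \<subseteq> \<Omega> \<and> lam \<le> l}. ennreal (mean (\<lambda>x. \<bar>f x\<bar>) (cube c l)))"

(* A function on \<Omega> is represented by a total function whose values outside \<Omega> are irrelevant. *)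
definition bmo :: "real \<Rightarrow> (real ^ 'n) set \<Rightarrow> (real ^ 'n \<Rightarrow> real) set" where
  "bmo lam \<Omega> = {f. (\<forall>c l. 0 < l \<and> cube c l \<subseteq> \<Omega> \<longrightarrow> f absolutely_integrable_on (cube c l))
                 \<and> bmo_norm lam \<Omega> f < \<infinity>}"

(* infdist to the empty set is 0, so the whole space is a separate case. *)
definition bdist :: "'a::metric_space set \<Rightarrow> 'a \<Rightarrow> ennreal" where
  "bdist \<Omega> z = (if \<Omega> = UNIV then \<infinity> else ennreal (infdist z (frontier \<Omega>)))"

definition arclength :: "(real \<Rightarrow> 'a::metric_space) \<Rightarrow> ennreal" where
  "arclength \<gamma> =
     (SUP (m, t) \<in> {(m, t :: nat \<Rightarrow> real). t 0 = 0 \<and> t m = 1 \<and> (\<forall>i<m. t i \<le> t (Suc i))}.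
        ennreal (\<Sum>i<m. dist (\<gamma> (t i)) (\<gamma> (t (Suc i)))))"

definition rectifiable :: "(real \<Rightarrow> 'a::metric_space) \<Rightarrow> bool" where
  "rectifiable \<gamma> \<longleftrightarrow> path \<gamma> \<and> arclength \<gamma> < \<infinity>"

(* Curves are parametrised by {0..1}. A point z of the curve is given by its parameter u,
   and the portions from x to z and from z to y are the subpaths over {0..u} and {u..1}. *)
definition locally_uniform :: "'a::euclidean_space set \<Rightarrow> bool" where
  "locally_uniform \<Omega> \<longleftrightarrow>
     (\<exists>a b \<delta> :: real. 1 \<le> a \<and> 1 \<le> b \<and> 0 < \<delta> \<and>
        (\<forall>x\<in>\<Omega>. \<forall>y\<in>\<Omega>. dist x y < \<delta> \<longrightarrow>
           (\<exists>\<gamma>. rectifiable \<gamma> \<and> path_image \<gamma> \<subseteq> \<Omega> \<and> pathstart \<gamma> = x \<and> pathfinish \<gamma> = y \<and>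
                arclength \<gamma> \<le> ennreal (a * dist x y) \<and>
                (\<forall>u\<in>{0..1}. min (arclength (subpath 0 u \<gamma>)) (arclength (subpath u 1 \<gamma>))
                             \<le> ennreal b * bdist \<Omega> (\<gamma> u)))))"

end

theory Submission
  imports Defs
begin

text \<open>
  Replace the quasihyperbolic metric by the combinatorial one in which a link joins two points
  whose distance is less than half of their distances to the boundary. The number of links needed
  to reach a set that contains all points at distance at least s from the boundary, with
  2 s at most \<open>\<lambda>\<close>, has mean oscillation bounded on every cube in \<open>\<Omega>\<close>, and bounded mean on the
  large cubes because it vanishes at their centres. Its norm thus does not depend on s, and comparing
  averages of the BMO extension over doubled cubes shows that it grows at most logarithmically:
  it varies by \<open>O(k + 1)\<close> between points whose distance is at most \<open>2^k\<close> times the smaller of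
  their distances to the boundary.

  Applied to the points at distance at least s from the boundary, this forces shortest chains
  ending there to be carrots. For x, y at a small distance r, take s = 4 r. The end points of the
  carrots from x and from y have mutual distance \<open>O(r)\<close>. Applied once more, with y's end point
  added to the points at distance at least a large multiple of r from the boundary, the estimate
  yields a chain of bounded length between the two end points: it is too short to reach that
  multiple of r. The concatenated polygon is the required curve.
\<close>

section \<open>Chains and their lengths\<close>

text \<open>The distance to the complement, rather than to the boundary, vanishes off the domain, so
  its positivity certifies membership. On the domain it is a lower bound for the boundary distance,
  which is the direction that the cone condition uses.\<close>

definition bd :: "'a::metric_space set \<Rightarrow> 'a \<Rightarrow> real" where
  "bd \<Omega> x = infdist x (- \<Omega>)"

text \<open>Since bd vanishes off the domain, links only join points of the domain. For the whole
  space bd is identically 0, so that this case is excluded throughout.\<close>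

definition link :: "'a::metric_space set \<Rightarrow> ('a \<times> 'a) set" where
  "link \<Omega> = {(x, y). dist x y < bd \<Omega> x / 2 \<and> dist x y < bd \<Omega> y / 2}"

text \<open>Where no chain reaches \<open>S\<close>, the \<open>LEAST\<close> of an unsatisfiable
  predicate is one fixed number. On a proper domain containing a nonempty \<open>S\<close>, every
  point has a chain to \<open>S\<close>.\<close>

definition hops :: "'a::metric_space set \<Rightarrow> 'a set \<Rightarrow> 'a \<Rightarrow> nat" where
  "hops \<Omega> S w = (LEAST n. \<exists>v\<in>S. (w, v) \<in> link \<Omega> ^^ n)"

lemma bd_nonneg: "0 \<le> bd \<Omega> x"
  unfolding bd_def by (rule infdist_nonneg)

lemma bd_lipschitz: "\<bar>bd \<Omega> x - bd \<Omega> y\<bar> \<le> dist x y"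
  unfolding bd_def by (rule infdist_triangle_abs)

lemma continuous_on_bd: "continuous_on A (bd \<Omega>)"
  unfolding bd_def[abs_def] by (intro continuous_intros)

lemma bd_pos_in: "0 < bd \<Omega> x \<Longrightarrow> x \<in> \<Omega>"
  unfolding bd_def by (rule ccontr) auto

lemma bd_pos:
  assumes "open \<Omega>" "\<Omega> \<noteq> UNIV" "x \<in> \<Omega>"
  shows "0 < bd \<Omega> x"
  unfolding bd_def using assms
  by (intro infdist_pos_not_in_closed) auto

lemma less_bd_in:
  assumes "dist x y < bd \<Omega> x" shows "y \<in> \<Omega>"
  using assms bd_lipschitz[of \<Omega> x y] by (intro bd_pos_in) linarith

lemma link_sym: "(x, y) \<in> link \<Omega> \<Longrightarrow> (y, x) \<in> link \<Omega>"
  by (auto simp: link_def dist_commute)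

lemma link_bd:
  assumes "(x, y) \<in> link \<Omega>"
  shows "0 < bd \<Omega> x" "0 < bd \<Omega> y" "dist x y < bd \<Omega> x / 2" "dist x y < bd \<Omega> y / 2"
    "bd \<Omega> y \<le> 2 * bd \<Omega> x" "bd \<Omega> x \<le> 2 * bd \<Omega> y"
proof -
  show 1: "dist x y < bd \<Omega> x / 2" "dist x y < bd \<Omega> y / 2"
    using assms by (auto simp: link_def)
  then show "0 < bd \<Omega> x" "0 < bd \<Omega> y"
    using zero_le_dist[of x y] by linarith+
  then show "bd \<Omega> y \<le> 2 * bd \<Omega> x" "bd \<Omega> x \<le> 2 * bd \<Omega> y"
    using 1 bd_lipschitz[of \<Omega> x y] by linarith+
qed

text \<open>By the Lipschitz bound \<open>bd \<Omega> y\<close> exceeds two thirds of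
  \<open>bd \<Omega> x\<close>, so closeness measured at \<open>x\<close> alone yields the symmetric
  condition.\<close>

lemma linkI:
  assumes "dist x y < bd \<Omega> x / 3"
  shows "(x, y) \<in> link \<Omega>"
  using assms bd_lipschitz[of \<Omega> x y] zero_le_dist[of x y] unfolding link_def by auto

text \<open>A union over \<open>u\<close> of sets given by strict inequalities between continuous
  functions of \<open>w\<close>. This is the source of the measurability of the chain
  length.\<close>

lemma open_link_pre: "open {w. \<exists>u\<in>T. (w, u) \<in> link \<Omega>}"
proof -
  have "{w. \<exists>u\<in>T. (w, u) \<in> link \<Omega>} =
      (\<Union>u\<in>T. {w. dist w u < bd \<Omega> w / 2} \<inter> {w. dist w u < bd \<Omega> u / 2})"
    by (auto simp: link_def)
  moreover have "open ({w. dist w u < bd \<Omega> w / 2} \<inter> {w. dist w u < bd \<Omega> u / 2})" for u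
    by (intro open_Int open_Collect_less continuous_intros continuous_on_bd) auto
  ultimately show ?thesis by auto
qed

text \<open>The set of points joined to \<open>S\<close> by exactly \<open>n\<close> links is open
  for positive \<open>n\<close> and equals \<open>S\<close> for \<open>n = 0\<close>.\<close>

lemma measurable_hops:
  assumes "S \<in> sets borel"
  shows "hops \<Omega> S \<in> measurable borel (count_space UNIV)"
proof -
  have "{w. \<exists>v\<in>S. (w, v) \<in> link \<Omega> ^^ n} \<in> sets borel" for n
  proof (cases n)
    case (Suc m)
    \<comment> \<open>Powers of a relation split off the last factor; here the first link, the one
      at \<open>w\<close>, has to be isolated.\<close>
    have eq: "link \<Omega> ^^ n = link \<Omega> O link \<Omega> ^^ m"
      unfolding Suc relpow.simps(2) by (rule relpow_commute[symmetric])
    have "{w. \<exists>v\<in>S. (w, v) \<in> link \<Omega> ^^ n} =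
        {w. \<exists>u\<in>{u. \<exists>v\<in>S. (u, v) \<in> link \<Omega> ^^ m}. (w, u) \<in> link \<Omega>}"
      unfolding eq relcomp_unfold by blast
    then show ?thesis by (simp only: borel_open[OF open_link_pre])
  qed (use assms in simp)
  then have "Measurable.pred borel (\<lambda>w. \<exists>v\<in>S. (w, v) \<in> link \<Omega> ^^ n)" for n
    by (simp add: pred_def)
  then have "(\<lambda>w. LEAST n. \<exists>v\<in>S. (w, v) \<in> link \<Omega> ^^ n) \<in> measurable borel (count_space UNIV)"
    by (rule measurable_Least)
  then show ?thesis by (simp add: hops_def[abs_def])
qed

lemma hops_le: "v \<in> S \<Longrightarrow> (w, v) \<in> link \<Omega> ^^ n \<Longrightarrow> hops \<Omega> S w \<le> n"
  unfolding hops_def by (rule Least_le) blast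

lemma hops_eq_0: "w \<in> S \<Longrightarrow> hops \<Omega> S w = 0"
  using hops_le[of w S w 0 \<Omega>] by simp

text \<open>Every point of the domain is linked to a whole ball around it, so the points reachable
  from \<open>x\<close> and the unreachable ones both form open sets; connectedness rules out the
  latter.\<close>

lemma link_connected:
  assumes "open \<Omega>" "connected \<Omega>" "\<Omega> \<noteq> UNIV" "x \<in> \<Omega>" "y \<in> \<Omega>"
  shows "(x, y) \<in> (link \<Omega>)\<^sup>*"
proof -
  define U where "U = {z \<in> \<Omega>. (x, z) \<in> (link \<Omega>)\<^sup>*}"
  define V where "V = {z \<in> \<Omega>. (x, z) \<notin> (link \<Omega>)\<^sup>*}"
  have near: "\<exists>e>0. \<forall>w. dist w z < e \<longrightarrow> w \<in> \<Omega> \<and> (z, w) \<in> link \<Omega>" if "z \<in> \<Omega>" for z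
  proof (intro exI conjI allI impI)
    show "0 < bd \<Omega> z / 3" using bd_pos assms that by fastforce
    fix w assume "dist w z < bd \<Omega> z / 3"
    then show "(z, w) \<in> link \<Omega>" by (intro linkI) (simp add: dist_commute)
    then show "w \<in> \<Omega>" using link_bd bd_pos_in by blast
  qed
  have "open U"
    unfolding open_dist
  proof
    fix z assume z: "z \<in> U"
    then obtain e where "e > 0" "\<forall>w. dist w z < e \<longrightarrow> w \<in> \<Omega> \<and> (z, w) \<in> link \<Omega>"
      using near unfolding U_def by blast
    with z show "\<exists>e>0. \<forall>w. dist w z < e \<longrightarrow> w \<in> U"
      unfolding U_def by (intro exI[of _ e]) (auto intro: rtrancl.rtrancl_into_rtrancl)
  qed
  moreover have "open V"
    unfolding open_dist
  proof
    fix z assume z: "z \<in> V"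
    then obtain e where "e > 0" "\<forall>w. dist w z < e \<longrightarrow> w \<in> \<Omega> \<and> (z, w) \<in> link \<Omega>"
      using near unfolding V_def by blast
    with z show "\<exists>e>0. \<forall>w. dist w z < e \<longrightarrow> w \<in> V"
      unfolding V_def by (intro exI[of _ e]) (auto dest: link_sym intro: rtrancl.rtrancl_into_rtrancl)
  qed
  moreover have eq: "U \<inter> V \<inter> \<Omega> = {}" "\<Omega> \<subseteq> U \<union> V"
    by (auto simp: U_def V_def)
  ultimately have "U \<inter> \<Omega> = {} \<or> V \<inter> \<Omega> = {}" using assms(2) by (intro connectedD)
  moreover have "x \<in> U" using assms by (simp add: U_def)
  ultimately have "y \<in> U" using assms eq by blast
  then show ?thesis by (simp add: U_def)
qed

section \<open>Shortest chains to a target set\<close>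

locale chain_target =
  fixes \<Omega> S :: "'a::metric_space set"
  assumes dom: "open \<Omega>" "connected \<Omega>" "\<Omega> \<noteq> UNIV"
    and target: "S \<subseteq> \<Omega>" "S \<noteq> {}"
begin

lemma hops_attained:
  assumes "w \<in> \<Omega>"
  obtains v where "v \<in> S" "(w, v) \<in> link \<Omega> ^^ hops \<Omega> S w"
proof -
  obtain v where v: "v \<in> S" using target by auto
  then have "(w, v) \<in> (link \<Omega>)\<^sup>*" using link_connected dom assms target by blast
  then obtain n where n: "(w, v) \<in> link \<Omega> ^^ n" using rtrancl_imp_relpow by blast
  with v have "\<exists>n. \<exists>v\<in>S. (w, v) \<in> link \<Omega> ^^ n" by blast
  from LeastI_ex[OF this] have "\<exists>v\<in>S. (w, v) \<in> link \<Omega> ^^ hops \<Omega> S w"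
    unfolding hops_def .
  with that show ?thesis by blast
qed

text \<open>Prepending the link to a shortest chain from the other end costs one step.\<close>

lemma hops_link:
  assumes "(w, w') \<in> link \<Omega>"
  shows "\<bar>real (hops \<Omega> S w) - real (hops \<Omega> S w')\<bar> \<le> 1"
proof -
  have le: "hops \<Omega> S w \<le> Suc (hops \<Omega> S w')" if l: "(w, w') \<in> link \<Omega>" for w w'
  proof -
    have "w' \<in> \<Omega>" using link_bd[OF l] bd_pos_in by blast
    then obtain v where "v \<in> S" "(w', v) \<in> link \<Omega> ^^ hops \<Omega> S w'" by (rule hops_attained)
    then show ?thesis by (meson hops_le l relpow_Suc_I2)
  qed
  show ?thesis using le[OF assms] le[OF link_sym[OF assms]] by linarith
qed

text \<open>The count drops by at most one per link and must reach 0 after all links, while the tail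
  of the chain bounds it from above; hence it drops by exactly one each time.\<close>

lemma minimal_chain:
  assumes "w \<in> \<Omega>"
  obtains g where "g 0 = w" "g (hops \<Omega> S w) \<in> S"
    "\<And>i. i < hops \<Omega> S w \<Longrightarrow> (g i, g (Suc i)) \<in> link \<Omega>"
    "\<And>i. i \<le> hops \<Omega> S w \<Longrightarrow> hops \<Omega> S (g i) = hops \<Omega> S w - i"
proof -
  let ?N = "hops \<Omega> S w"
  obtain v where v: "v \<in> S" "(w, v) \<in> link \<Omega> ^^ ?N" using hops_attained[OF assms] .
  then obtain g where g: "g 0 = w" "g ?N = v" "\<forall>i<?N. (g i, g (Suc i)) \<in> link \<Omega>"
    using relpow_fun_conv by metis
  have lo: "real ?N - real i \<le> real (hops \<Omega> S (g i))" if "i \<le> ?N" for i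
    using that
  proof (induction i)
    case (Suc i)
    then show ?case using hops_link[of "g i" "g (Suc i)"] g(3) by fastforce
  qed (simp add: g)
  have up: "hops \<Omega> S (g i) \<le> ?N - i" if "i \<le> ?N" for i
  proof (rule hops_le[OF v(1)])
    have "\<exists>f. f 0 = g i \<and> f (?N - i) = v \<and> (\<forall>j<?N - i. (f j, f (Suc j)) \<in> link \<Omega>)"
      using that g by (intro exI[of _ "\<lambda>j. g (i + j)"]) auto
    then show "(g i, v) \<in> link \<Omega> ^^ (?N - i)" by (simp add: relpow_fun_conv)
  qed
  have "hops \<Omega> S (g i) = ?N - i" if "i \<le> ?N" for i
    using lo[OF that] up[OF that] that by linarith
  then show ?thesis using that g v by blast
qed

lemma hops_near:
  assumes "dist x w < bd \<Omega> x / 3"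
  shows "\<bar>real (hops \<Omega> S w) - real (hops \<Omega> S x)\<bar> \<le> 1"
  using hops_link[OF linkI[OF assms]] by linarith

end

section \<open>Means over cubes\<close>

lemma mem_cube: "z \<in> cube c l \<longleftrightarrow> (\<forall>i. c $ i \<le> z $ i \<and> z $ i \<le> c $ i + l)"
  by (simp add: cube_def mem_box_cart)

lemma measure_cube:
  fixes c :: "real ^ 'n"
  assumes "0 \<le> l"
  shows "measure lebesgue (cube c l) = l ^ CARD('n)"
proof -
  have "c \<in> cube c l" using assms by (simp add: mem_cube)
  then have "cbox c (\<chi> i. c $ i + l) \<noteq> {}" by (auto simp: cube_def)
  then show ?thesis by (simp add: cube_def content_cbox_cart)
qed

lemma lmeasurable_cube: "cube c l \<in> lmeasurable"
  by (simp add: cube_def)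

lemma sets_cube: "cube c l \<in> sets lebesgue"
  by (simp add: cube_def)

lemma emeasure_cube: "emeasure lebesgue (cube c l) = ennreal (measure lebesgue (cube c l))"
  using fmeasurableD2[OF lmeasurable_cube] by (rule emeasure_eq_ennreal_measure)

lemma set_integrable_const_cube: "set_integrable lebesgue (cube c l) (\<lambda>_. k :: real)"
  unfolding set_integrable_def
  using lmeasurable_cube[of c l] by (intro integrable_scaleR_left integrable_real_indicator) (auto simp: fmeasurable_def)

lemma set_integral_const_cube:
  "(LINT x:cube c l|lebesgue. k) = measure lebesgue (cube c l) * (k :: real)"
  using lmeasurable_cube[of c l] by (subst set_integral_const) (auto simp: fmeasurable_def)

lemma mean_diff_const:
  fixes c :: "real ^ 'n"
  assumes "set_integrable lebesgue (cube c l) F" "0 < l"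
  shows "mean (\<lambda>x. F x - k) (cube c l) = mean F (cube c l) - k"
  using assms unfolding mean_def
  by (simp add: set_integrable_const_cube set_integral_const_cube measure_cube diff_divide_distrib)

text \<open>The integral of \<open>\<bar>F x - k\<bar>\<close> only grows when passing to the larger
  cube; the factor is the ratio of the volumes.\<close>

lemma abs_mean_diff_le:
  fixes c :: "real ^ 'n"
  assumes F: "set_integrable lebesgue (cube c l) F"
    and l: "0 < l'" "0 < l" and sub: "cube c' l' \<subseteq> cube c l"
  shows "\<bar>mean F (cube c' l') - k\<bar> \<le> (l / l') ^ CARD('n) * mean (\<lambda>x. \<bar>F x - k\<bar>) (cube c l)"
proof -
  have F': "set_integrable lebesgue (cube c' l') F"
    by (rule set_integrable_subset[OF F sets_cube sub])
  have int: "set_integrable lebesgue (cube c l) (\<lambda>x. \<bar>F x - k\<bar>)"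
    using F by (intro set_integrable_abs set_integral_diff set_integrable_const_cube)
  have int': "set_integrable lebesgue (cube c' l') (\<lambda>x. F x - k)"
    using F' by (intro set_integral_diff set_integrable_const_cube)
  have "\<bar>LINT x:cube c' l'|lebesgue. F x - k\<bar> \<le> (LINT x:cube c' l'|lebesgue. \<bar>F x - k\<bar>)"
    using set_integral_norm_bound[OF int'] by simp
  also have "\<dots> \<le> (LINT x:cube c l|lebesgue. \<bar>F x - k\<bar>)"
    using int int' sub unfolding set_lebesgue_integral_def set_integrable_def
    by (intro integral_mono' mult_right_mono) (auto simp: indicator_def)
  finally have *: "\<bar>LINT x:cube c' l'|lebesgue. F x - k\<bar> / l' ^ CARD('n)
      \<le> (LINT x:cube c l|lebesgue. \<bar>F x - k\<bar>) / l' ^ CARD('n)"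
    using l by (intro divide_right_mono) auto
  have "\<bar>mean F (cube c' l') - k\<bar> = \<bar>LINT x:cube c' l'|lebesgue. F x - k\<bar> / l' ^ CARD('n)"
    unfolding mean_diff_const[OF F' l(1), of k, symmetric] using l
    by (simp add: mean_def measure_cube)
  with * show ?thesis
    using l by (simp add: mean_def measure_cube power_divide)
qed

lemma abs_mean_sub_cube_le:
  fixes c :: "real ^ 'n"
  assumes "set_integrable lebesgue (cube c l) F" "0 < l'" "0 < l" "cube c' l' \<subseteq> cube c l"
  shows "\<bar>mean F (cube c' l') - mean F (cube c l)\<bar> \<le> (l / l') ^ CARD('n) * mean_osc F (cube c l)"
  using abs_mean_diff_le[OF assms] by (simp add: mean_osc_def)

lemma mean_mono:
  fixes c :: "real ^ 'n"
  assumes "set_integrable lebesgue (cube c l) F" "set_integrable lebesgue (cube c l) G" "0 < l"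
    and "\<And>x. x \<in> cube c l \<Longrightarrow> F x \<le> G x"
  shows "mean F (cube c l) \<le> mean G (cube c l)"
  unfolding mean_def using assms
  by (intro divide_right_mono set_integral_mono) auto

lemma mean_const:
  assumes "0 < l"
  shows "mean (\<lambda>_. k) (cube c l) = k"
  using assms unfolding mean_def set_integral_const_cube by (simp add: measure_cube)

text \<open>Replacing the mean by an arbitrary constant costs a factor 2, since the mean itself
  differs from \<open>k\<close> by at most the mean of \<open>\<bar>F x - k\<bar>\<close>.\<close>

lemma mean_osc_le:
  fixes c :: "real ^ 'n"
  assumes F: "set_integrable lebesgue (cube c l) F" and l: "0 < l"
  shows "mean_osc F (cube c l) \<le> 2 * mean (\<lambda>x. \<bar>F x - k\<bar>) (cube c l)"
proof -
  let ?Q = "cube c l"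
  have int: "set_integrable lebesgue ?Q (\<lambda>x. \<bar>F x - a\<bar>)" for a
    using F by (intro set_integrable_abs set_integral_diff set_integrable_const_cube)
  \<comment> \<open>The sum is written as a subtraction of a negative constant so that
    \<open>mean_diff_const\<close> applies.\<close>
  have "mean_osc F ?Q \<le> mean (\<lambda>x. \<bar>F x - k\<bar> - - \<bar>mean F ?Q - k\<bar>) ?Q"
    unfolding mean_osc_def
    by (intro mean_mono int set_integral_diff set_integrable_const_cube l) auto
  also have "\<dots> = mean (\<lambda>x. \<bar>F x - k\<bar>) ?Q + \<bar>mean F ?Q - k\<bar>"
    by (subst mean_diff_const[OF int l]) simp
  also have "\<bar>mean F ?Q - k\<bar> \<le> mean (\<lambda>x. \<bar>F x - k\<bar>) ?Q"
    using abs_mean_diff_le[OF F l l order_refl, of k] l by simp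
  finally show ?thesis by simp
qed

text \<open>Closed balls of the sup norm: with centre and half side as parameters, concentric
  dilation only changes \<open>r\<close>.\<close>

definition ccube :: "real ^ 'n \<Rightarrow> real \<Rightarrow> (real ^ 'n) set" where
  "ccube x r = cube (\<chi> i. x $ i - r) (2 * r)"

lemma mem_ccube: "z \<in> ccube x r \<longleftrightarrow> (\<forall>i. \<bar>z $ i - x $ i\<bar> \<le> r)"
  unfolding ccube_def mem_cube by (auto simp: abs_le_iff algebra_simps)

lemma ccube_mono: "r \<le> s \<Longrightarrow> ccube x r \<subseteq> ccube x s"
  unfolding mem_ccube subset_iff by (meson order_trans)

lemma cube_eq_ccube: "cube c l = ccube (\<chi> i. c $ i + l / 2) (l / 2)"
  by (simp add: ccube_def vec_eq_iff)

lemma dist_le_of_mem_ccube: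
  fixes x :: "real ^ 'n"
  assumes "z \<in> ccube x r"
  shows "dist x z \<le> real CARD('n) * r"
proof -
  have "norm (z - x) \<le> (\<Sum>i\<in>UNIV. \<bar>(z - x) $ i\<bar>)" by (rule norm_le_l1_cart)
  also have "\<dots> \<le> (\<Sum>i\<in>(UNIV :: 'n set). r)"
    using assms by (intro sum_mono) (auto simp: mem_ccube)
  finally show ?thesis by (simp add: dist_norm norm_minus_commute)
qed

section \<open>Averages of a BMO function over doubled cubes\<close>

lemma mean_osc_le_BMO_norm:
  assumes "BMO_norm F \<le> ennreal B" "0 \<le> B" "0 < l"
  shows "mean_osc F (cube c l) \<le> B"
proof -
  have "ennreal (mean_osc F (cube c l)) \<le> BMO_norm F"
    unfolding BMO_norm_def using assms by (intro SUP_upper2[of "(c, l)"]) auto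
  then show ?thesis using assms by (metis ennreal_le_iff order_trans)
qed

lemma mean_ccube_doubling:
  fixes x :: "real ^ 'n"
  assumes F: "F \<in> BMO" "BMO_norm F \<le> ennreal B" "0 \<le> B" and r: "0 < r"
    and sub: "ccube y r \<subseteq> ccube x (2 * r)"
  shows "\<bar>mean F (ccube y r) - mean F (ccube x (2 * r))\<bar> \<le> 2 ^ CARD('n) * B"
proof -
  have "compact (ccube x (2 * r))" by (simp add: ccube_def cube_def)
  then have "set_integrable lebesgue (ccube x (2 * r)) F" using F(1) by (auto simp: BMO_def)
  then have "\<bar>mean F (ccube y r) - mean F (ccube x (2 * r))\<bar>
      \<le> (2 * (2 * r) / (2 * r)) ^ CARD('n) * mean_osc F (ccube x (2 * r))"
    using sub r unfolding ccube_def by (intro abs_mean_sub_cube_le) auto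
  also have "\<dots> \<le> 2 ^ CARD('n) * B"
    using mean_osc_le_BMO_norm[OF F(2,3), of "2 * (2 * r)"] r unfolding ccube_def by simp
  finally show ?thesis .
qed

lemma mean_ccube_power:
  fixes x :: "real ^ 'n"
  assumes F: "F \<in> BMO" "BMO_norm F \<le> ennreal B" "0 \<le> B" and r: "0 < r"
  shows "\<bar>mean F (ccube x r) - mean F (ccube x (2 ^ k * r))\<bar> \<le> real k * (2 ^ CARD('n) * B)"
proof (induction k)
  case (Suc k)
  have "\<bar>mean F (ccube x (2 ^ k * r)) - mean F (ccube x (2 * (2 ^ k * r)))\<bar> \<le> 2 ^ CARD('n) * B"
    using r by (intro mean_ccube_doubling[OF F] ccube_mono) auto
  with Suc show ?case by (simp add: algebra_simps)
qed simp

text \<open>Doubling \<open>k\<close> times around each point gives two cubes of half side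
  \<open>2 ^ k * r\<close> that both fit into the next dilate around \<open>x\<close>. This makes
  \<open>k\<close> comparisons on either side and two more at the top.\<close>

lemma mean_ccube_pair:
  fixes x y :: "real ^ 'n"
  assumes F: "F \<in> BMO" "BMO_norm F \<le> ennreal B" "0 \<le> B" and r: "0 < r"
    and k: "dist x y \<le> 2 ^ k * r"
  shows "\<bar>mean F (ccube x r) - mean F (ccube y r)\<bar> \<le> real (2 * k + 2) * (2 ^ CARD('n) * B)"
proof -
  let ?R = "2 ^ k * r"
  have sub: "ccube y ?R \<subseteq> ccube x (2 * ?R)"
  proof
    fix z assume z: "z \<in> ccube y ?R"
    have near: "\<bar>y $ i - x $ i\<bar> \<le> ?R" for i
      using component_le_norm_cart[of "y - x" i] k by (simp add: dist_norm norm_minus_commute)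
    have "\<bar>z $ i - x $ i\<bar> \<le> 2 * ?R" for i
      using near[of i] z[unfolded mem_ccube, rule_format, of i] by linarith
    then show "z \<in> ccube x (2 * ?R)" by (simp add: mem_ccube)
  qed
  have "\<bar>mean F (ccube y ?R) - mean F (ccube x (2 * ?R))\<bar> \<le> 2 ^ CARD('n) * B"
    "\<bar>mean F (ccube x ?R) - mean F (ccube x (2 * ?R))\<bar> \<le> 2 ^ CARD('n) * B"
    using r sub by (intro mean_ccube_doubling[OF F] ccube_mono; simp)+
  with mean_ccube_power[OF F r, of x k] mean_ccube_power[OF F r, of y k]
  show ?thesis by (simp add: algebra_simps)
qed

section \<open>Oscillation of the chain length\<close>

lemma measurable_hops_real:
  fixes S :: "'a::euclidean_space set"
  assumes "S \<in> sets borel"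
  shows "(\<lambda>w. real (hops \<Omega> S w)) \<in> borel_measurable lebesgue"
proof -
  have "(\<lambda>w. real (hops \<Omega> S w)) \<in> borel_measurable borel"
    using measurable_hops[OF assms, of \<Omega>] by measurable
  then show ?thesis by (intro measurable_completion) simp
qed

text \<open>A point off the domain has a coordinate at distance more than \<open>h\<close> from that
  of \<open>q\<close>, and in this coordinate \<open>z\<close> is within \<open>h - t\<close> of
  \<open>q\<close>.\<close>

lemma bd_ge_of_ccube:
  fixes \<Omega> :: "(real ^ 'n) set"
  assumes sub: "ccube q h \<subseteq> \<Omega>" and "\<Omega> \<noteq> UNIV" and z: "z \<in> ccube q (h - t)"
  shows "t \<le> bd \<Omega> z"
proof -
  have "t \<le> dist z w" if "w \<in> - \<Omega>" for w
  proof -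
    have "w \<notin> ccube q h" using sub that by auto
    then obtain i where "h < \<bar>w $ i - q $ i\<bar>" by (auto simp: mem_ccube not_le)
    moreover have "\<bar>z $ i - q $ i\<bar> \<le> h - t" using z by (simp add: mem_ccube)
    moreover have "\<bar>z $ i - w $ i\<bar> \<le> dist z w"
      using component_le_norm_cart[of "z - w" i] by (simp add: dist_norm)
    ultimately show ?thesis by linarith
  qed
  then show ?thesis
    using assms(2) unfolding bd_def infdist_def by (auto intro!: cINF_greatest)
qed

locale chain_target_vec = chain_target \<Omega> S for \<Omega> S :: "(real ^ 'n) set" +
  assumes borel_target: "S \<in> sets borel"
begin

abbreviation chain_len :: "real ^ 'n \<Rightarrow> real" where
  "chain_len w \<equiv> real (hops \<Omega> S w)"

text \<open>The ratio th is chosen such that consecutive concentric cubes of half side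
  \<open>(1 - th ^ k) * h\<close> are one link apart.\<close>

lemma hops_ccube:
  fixes th :: real
  assumes th: "th * (4 * real CARD('n) + 1) = 4 * real CARD('n)"
  assumes sub: "ccube q h \<subseteq> \<Omega>" and h: "0 < h" and z: "z \<in> ccube q ((1 - th ^ k) * h)"
  shows "\<bar>chain_len z - chain_len q\<bar> \<le> real k"
  using z
proof (induction k arbitrary: z)
  case 0
  then have "z = q" by (simp add: mem_ccube vec_eq_iff)
  then show ?case by simp
next
  case (Suc k)
  let ?n = "real CARD('n)"
  have th_eq: "th = 4 * ?n / (4 * ?n + 1)" using th by (simp add: field_simps)
  have th01: "0 < th" "th < 1" by (simp_all add: th_eq field_simps)
  have pk: "th ^ Suc k \<le> th ^ k" "th ^ Suc k < 1" "0 < th ^ Suc k" "th ^ k \<le> 1"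
    using th01 power_Suc_less_one[OF th01]
    by (auto simp del: power_Suc intro: power_decreasing power_le_one)
  \<comment> \<open>Ratio of the half sides of two consecutive cubes: scaling by it about
    \<open>q\<close> moves \<open>z\<close> into the smaller cube, where the induction hypothesis
    applies.\<close>
  define \<beta> where "\<beta> = (1 - th ^ k) / (1 - th ^ Suc k)"
  have \<beta>: "0 \<le> \<beta>" "\<beta> \<le> 1" using pk by (auto simp: \<beta>_def field_simps)
  have \<beta>eq: "\<beta> * (1 - th ^ Suc k) = 1 - th ^ k" using pk by (simp add: \<beta>_def)
  define z' where "z' = q + \<beta> *\<^sub>R (z - q)"
  have comp: "\<bar>z $ i - q $ i\<bar> \<le> (1 - th ^ Suc k) * h" for i
    using Suc.prems by (simp add: mem_ccube)
  have z'_in: "z' \<in> ccube q ((1 - th ^ k) * h)"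
    unfolding mem_ccube
  proof
    fix i
    have "\<bar>z' $ i - q $ i\<bar> = \<beta> * \<bar>z $ i - q $ i\<bar>" using \<beta> by (simp add: z'_def abs_mult)
    also have "\<dots> \<le> \<beta> * ((1 - th ^ Suc k) * h)" using \<beta> comp by (intro mult_left_mono)
    also have "\<dots> = (1 - th ^ k) * h" using \<beta>eq by (simp add: mult.assoc[symmetric])
    finally show "\<bar>z' $ i - q $ i\<bar> \<le> (1 - th ^ k) * h" .
  qed
  have "dist z z' = (1 - \<beta>) * dist q z"
  proof -
    have "z - z' = (1 - \<beta>) *\<^sub>R (z - q)" by (simp add: z'_def algebra_simps)
    then show ?thesis using \<beta> by (simp add: dist_norm norm_minus_commute)
  qed
  also have "\<dots> \<le> (1 - \<beta>) * (?n * ((1 - th ^ Suc k) * h))"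
    using \<beta> dist_le_of_mem_ccube[OF Suc.prems] by (intro mult_left_mono) auto
  also have "\<dots> = ?n * (((1 - th ^ Suc k) - \<beta> * (1 - th ^ Suc k)) * h)"
    by (simp add: algebra_simps)
  also have "\<dots> = ?n * (th ^ k - th ^ Suc k) * h"
    unfolding \<beta>eq by simp
  \<comment> \<open>The equation for \<open>th\<close> says that
    \<open>n * (1 - th) = th / 4\<close>. A quarter is below the third required by
    \<open>hops_near\<close>, since \<open>bd \<Omega> z\<close> is at least
    \<open>th ^ Suc k * h\<close>.\<close>
  also have "\<dots> = th ^ Suc k * h / 4"
  proof -
    have "th * (4 * ?n) + th = 4 * ?n" using th by (simp add: algebra_simps)
    then have "?n * (1 - th) = th / 4" by (simp add: algebra_simps)
    then have "th ^ k * h * (?n * (1 - th)) = th ^ k * h * (th / 4)" by (simp only:)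
    moreover have "?n * (th ^ k - th ^ Suc k) * h = th ^ k * h * (?n * (1 - th))"
      by (simp add: algebra_simps)
    moreover have "th ^ Suc k * h / 4 = th ^ k * h * (th / 4)" by simp
    ultimately show ?thesis by (simp only:)
  qed
  also have "\<dots> < th ^ Suc k * h / 3" using pk h by simp
  finally have d: "dist z z' < th ^ Suc k * h / 3" .
  have "th ^ Suc k * h \<le> bd \<Omega> z"
    using Suc.prems by (intro bd_ge_of_ccube[OF sub dom(3)]) (simp add: algebra_simps)
  with d have "\<bar>chain_len z' - chain_len z\<bar> \<le> 1" by (intro hops_near) linarith
  with Suc.IH[OF z'_in] show ?case by simp
qed

text \<open>The deviation at \<open>z\<close> is at most the number of cubes \<open>Q k\<close> that
  miss \<open>z\<close>, so the integral is at most the sum of the volumes of the complements of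
  \<open>Q k\<close> in the cube. These decay geometrically with ratio \<open>th\<close>, and
  \<open>1 / (1 - th) = 4 * n + 1\<close>.\<close>

lemma nn_integral_hops_ccube:
  assumes sub: "ccube q h \<subseteq> \<Omega>" and h: "0 < h"
  shows "(\<integral>\<^sup>+ z. ennreal (indicator (ccube q h) z * \<bar>chain_len z - chain_len q\<bar>) \<partial>lebesgue)
    \<le> ennreal (real CARD('n) * (4 * real CARD('n) + 1) * (2 * h) ^ CARD('n))"
proof -
  let ?n = "real CARD('n)"
  define th where "th = 4 * ?n / (4 * ?n + 1)"
  have th: "0 < th" "th < 1" by (simp_all add: th_def field_simps)
  have th_eq: "th * (4 * ?n + 1) = 4 * ?n" by (simp add: th_def)
  define Q where "Q k = ccube q ((1 - th ^ k) * h)" for k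
  have Q_sets: "Q k \<in> sets lebesgue" "ccube q h \<in> sets lebesgue" for k
    by (auto simp: Q_def ccube_def sets_cube)
  have le: "ennreal (indicator (ccube q h) z * \<bar>chain_len z - chain_len q\<bar>) \<le> (\<Sum>k. indicator (ccube q h - Q k) z)" for z
  proof (cases "z \<in> ccube q h \<and> (\<exists>k. z \<in> Q k)")
    case True
    \<comment> \<open>The least such index makes each of the first \<open>m\<close> indicators equal
      to 1 at \<open>z\<close>.\<close>
    define m where "m = (LEAST k. z \<in> Q k)"
    have m: "z \<in> Q m" "\<And>k. k < m \<Longrightarrow> z \<notin> Q k"
      unfolding m_def using True LeastI_ex[of "\<lambda>k. z \<in> Q k"] not_less_Least by auto
    have "ennreal (indicator (ccube q h) z * \<bar>chain_len z - chain_len q\<bar>) \<le> ennreal (real m)"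
      using hops_ccube[OF th_eq sub h] m(1) True by (intro ennreal_leI) (simp add: Q_def)
    also have "\<dots> = (\<Sum>k<m. indicator (ccube q h - Q k) z)"
      using m(2) True by (simp add: ennreal_of_nat_eq_real_of_nat[symmetric])
    also have "\<dots> \<le> (\<Sum>k. indicator (ccube q h - Q k) z)"
      by (intro sum_le_suminf) auto
    finally show ?thesis .
  next
    case False
    show ?thesis
    proof (cases "z \<in> ccube q h")
      \<comment> \<open>On the boundary of the cube, \<open>z\<close> lies in no \<open>Q k\<close>;
        the series diverges and the bound is trivial.\<close>
      case True
      then have "(\<Sum>k. indicator (ccube q h - Q k) z) = (\<Sum>k. 1 :: ennreal)"
        using False by (intro suminf_cong) simp
      also have "\<dots> = \<infinity>"
      proof (rule ccontr)
        assume "(\<Sum>k. 1 :: ennreal) \<noteq> \<infinity>"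
        then obtain r where r: "(\<Sum>k. 1 :: ennreal) = ennreal r" "0 \<le> r"
          by (metis ennreal_cases infinity_ennreal_def)
        obtain N :: nat where N: "r < real N" using reals_Archimedean2 by blast
        have "(\<Sum>k<N. 1 :: ennreal) \<le> (\<Sum>k. 1)" by (intro sum_le_suminf) auto
        then have "ennreal (real N) \<le> ennreal r" using r by (simp add: ennreal_of_nat_eq_real_of_nat)
        then show False using N r by (simp add: ennreal_le_iff)
      qed
      finally show ?thesis by simp
    qed simp
  qed
  have meas: "emeasure lebesgue (ccube q h - Q k) \<le> ennreal (?n * th ^ k * (2 * h) ^ CARD('n))" for k
  proof -
    have p: "0 \<le> th ^ k" "th ^ k \<le> 1" using th by (auto intro: power_le_one)
    have "Q k \<subseteq> ccube q h"
      unfolding Q_def using p h by (intro ccube_mono) (simp add: mult_le_cancel_right1)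
    then have "emeasure lebesgue (ccube q h - Q k) =
        emeasure lebesgue (ccube q h) - emeasure lebesgue (Q k)"
      using Q_sets by (intro emeasure_Diff) (auto simp: Q_def ccube_def emeasure_cube)
    also have "\<dots> = ennreal ((2 * h) ^ CARD('n)) - ennreal ((2 * ((1 - th ^ k) * h)) ^ CARD('n))"
      using h p by (simp add: Q_def ccube_def emeasure_cube measure_cube)
    also have "\<dots> = ennreal ((2 * h) ^ CARD('n) - (2 * ((1 - th ^ k) * h)) ^ CARD('n))"
      using h p by (intro ennreal_minus) simp
    also have "\<dots> \<le> ennreal (?n * th ^ k * (2 * h) ^ CARD('n))"
    proof (rule ennreal_leI)
      \<comment> \<open>Bernoulli's inequality: removing the concentric cube of relative size
        \<open>1 - t\<close> leaves at most the fraction \<open>n * t\<close> of the volume.\<close>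
      have "1 + ?n * (- (th ^ k)) \<le> (1 + - (th ^ k)) ^ CARD('n)"
        using p by (intro Bernoulli_inequality) auto
      then have "(1 - ?n * th ^ k) * (2 * h) ^ CARD('n) \<le> (1 - th ^ k) ^ CARD('n) * (2 * h) ^ CARD('n)"
        using h by (intro mult_right_mono) auto
      also have "\<dots> = (2 * ((1 - th ^ k) * h)) ^ CARD('n)"
        by (simp add: power_mult_distrib)
      finally show "(2 * h) ^ CARD('n) - (2 * ((1 - th ^ k) * h)) ^ CARD('n)
          \<le> ?n * th ^ k * (2 * h) ^ CARD('n)" by (simp add: algebra_simps)
    qed
    finally show ?thesis .
  qed
  have "(\<integral>\<^sup>+ z. ennreal (indicator (ccube q h) z * \<bar>chain_len z - chain_len q\<bar>) \<partial>lebesgue)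
      \<le> (\<integral>\<^sup>+ z. (\<Sum>k. indicator (ccube q h - Q k) z) \<partial>lebesgue)"
    by (intro nn_integral_mono le)
  also have "\<dots> = (\<Sum>k. \<integral>\<^sup>+ z. indicator (ccube q h - Q k) z \<partial>lebesgue)"
    using Q_sets by (intro nn_integral_suminf) auto
  also have "\<dots> = (\<Sum>k. emeasure lebesgue (ccube q h - Q k))"
    using Q_sets by (intro suminf_cong nn_integral_indicator) auto
  also have "\<dots> \<le> (\<Sum>k. ennreal (?n * th ^ k * (2 * h) ^ CARD('n)))"
    by (intro suminf_le meas) auto
  also have "\<dots> = ennreal (?n * (4 * ?n + 1) * (2 * h) ^ CARD('n))"
  proof (rule suminf_ennreal_eq)
    show "0 \<le> ?n * th ^ k * (2 * h) ^ CARD('n)" for k using th h by simp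
    have "(\<lambda>k. th ^ k) sums (1 / (1 - th))" using th by (intro geometric_sums) simp
    also have "1 / (1 - th) = 4 * ?n + 1" by (simp add: th_def field_simps)
    finally show "(\<lambda>k. ?n * th ^ k * (2 * h) ^ CARD('n)) sums (?n * (4 * ?n + 1) * (2 * h) ^ CARD('n))"
      by (intro sums_mult sums_mult2)
  qed
  finally show ?thesis .
qed

lemma hops_ccube_integrable:
  assumes sub: "ccube q h \<subseteq> \<Omega>" and h: "0 < h"
  shows "set_integrable lebesgue (ccube q h) chain_len"
    and "mean (\<lambda>z. \<bar>chain_len z - chain_len q\<bar>) (ccube q h) \<le> real CARD('n) * (4 * real CARD('n) + 1)"
proof -
  let ?n = "real CARD('n)"
  note bnd = nn_integral_hops_ccube[OF assms]
  have sets: "ccube q h \<in> sets lebesgue" by (simp add: ccube_def sets_cube)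
  have int: "set_integrable lebesgue (ccube q h) (\<lambda>z. chain_len z - chain_len q)"
    unfolding set_integrable_def
  proof (rule integrableI_bounded)
    show "(\<lambda>z. indicat_real (ccube q h) z *\<^sub>R (chain_len z - chain_len q)) \<in> borel_measurable lebesgue"
      using sets measurable_hops_real[OF borel_target, of \<Omega>] by measurable
    show "(\<integral>\<^sup>+ z. ennreal (norm (indicat_real (ccube q h) z *\<^sub>R (chain_len z - chain_len q))) \<partial>lebesgue) < \<infinity>"
      using le_less_trans[OF bnd ennreal_less_top] by (simp add: abs_mult)
  qed
  then have "set_integrable lebesgue (ccube q h) (\<lambda>z. chain_len z - chain_len q - - chain_len q)"
    unfolding ccube_def by (rule set_integral_diff(1)[OF _ set_integrable_const_cube])
  then show "set_integrable lebesgue (ccube q h) chain_len" by simp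
  have "(LINT z:ccube q h|lebesgue. \<bar>chain_len z - chain_len q\<bar>) \<le> ?n * (4 * ?n + 1) * (2 * h) ^ CARD('n)"
    unfolding set_lebesgue_integral_def
  proof (rule integral_real_bounded)
    show "(\<integral>\<^sup>+ z. ennreal (indicat_real (ccube q h) z *\<^sub>R \<bar>chain_len z - chain_len q\<bar>) \<partial>lebesgue)
        \<le> ennreal (?n * (4 * ?n + 1) * (2 * h) ^ CARD('n))"
      using bnd by simp
  qed (use h in simp)
  then show "mean (\<lambda>z. \<bar>chain_len z - chain_len q\<bar>) (ccube q h) \<le> ?n * (4 * ?n + 1)"
    using h unfolding mean_def ccube_def by (simp add: measure_cube field_simps)
qed

text \<open>The deviation from the value at the centre has bounded mean on every cube, which bounds
  the oscillation by twice as much. A cube of side at least \<open>lam\<close> has its centre in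
  \<open>S\<close>, where the chain length is 0, so there the same mean bounds
  \<open>\<bar>f\<bar>\<close> itself. The bound depends neither on \<open>s\<close> nor on
  \<open>S\<close>.\<close>

lemma chain_len_bmo:
  assumes s: "2 * s \<le> lam" and fat: "{z \<in> \<Omega>. s \<le> bd \<Omega> z} \<subseteq> S"
  shows "chain_len \<in> bmo lam \<Omega>"
    and "bmo_norm lam \<Omega> chain_len \<le> ennreal (3 * (real CARD('n) * (4 * real CARD('n) + 1)))"
proof -
  define A where "A = real CARD('n) * (4 * real CARD('n) + 1)"
  have A: "0 \<le> A" by (simp add: A_def)
  define q :: "real ^ 'n \<Rightarrow> real \<Rightarrow> real ^ 'n" where "q c l = (\<chi> i. c $ i + l / 2)" for c l
  have cc: "cube c l = ccube (q c l) (l / 2)" for c l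
    unfolding q_def by (rule cube_eq_ccube)
  have int: "set_integrable lebesgue (cube c l) chain_len"
    and mean: "mean (\<lambda>z. \<bar>chain_len z - chain_len (q c l)\<bar>) (cube c l) \<le> A"
    if "0 < l" "cube c l \<subseteq> \<Omega>" for c l
    using hops_ccube_integrable[of "q c l" "l / 2"] that unfolding A_def cc by auto
  have osc: "mean_osc chain_len (cube c l) \<le> 2 * A" if "0 < l" "cube c l \<subseteq> \<Omega>" for c l
    using mean_osc_le[OF int[OF that] that(1), of "chain_len (q c l)"] mean[OF that] by linarith
  have large: "mean (\<lambda>x. \<bar>chain_len x\<bar>) (cube c l) \<le> A" if "0 < l" "cube c l \<subseteq> \<Omega>" "lam \<le> l" for c l
  proof -
    have sub: "ccube (q c l) (l / 2) \<subseteq> \<Omega>" using that cc by simp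
    \<comment> \<open>The case \<open>t = h\<close> of the estimate: the inner cube degenerates to
      the centre.\<close>
    then have "l / 2 \<le> bd \<Omega> (q c l)"
      using dom by (intro bd_ge_of_ccube[of _ "l / 2"]) (auto simp: mem_ccube)
    moreover have "q c l \<in> ccube (q c l) (l / 2)" using that by (simp add: mem_ccube)
    ultimately have "q c l \<in> S" using s that fat sub by auto
    then show ?thesis using mean[OF that(1,2)] by (simp add: hops_eq_0)
  qed
  have "bmo_norm lam \<Omega> chain_len \<le> ennreal (2 * A) + ennreal A"
    unfolding bmo_norm_def using osc large
    by (intro add_mono SUP_least) (auto intro!: ennreal_leI)
  also have "\<dots> = ennreal (3 * A)" using A by (simp add: ennreal_plus[symmetric] del: ennreal_plus)
  finally show *: "bmo_norm lam \<Omega> chain_len \<le> ennreal (3 * (real CARD('n) * (4 * real CARD('n) + 1)))"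
    unfolding A_def .
  then have "bmo_norm lam \<Omega> chain_len < \<infinity>"
    using le_less_trans[OF _ ennreal_less_top] by auto
  then show "chain_len \<in> bmo lam \<Omega>"
    unfolding bmo_def using int by auto
qed

text \<open>On small cubes around \<open>x\<close> and \<open>y\<close> the extension
  \<open>F\<close> agrees with the chain length, which varies there by at most 1 from its value at
  the centre. Hence the two values may be replaced by averages of \<open>F\<close>, which BMO
  controls.\<close>

lemma chain_len_diff_le:
  assumes F: "F \<in> BMO" "BMO_norm F \<le> ennreal B" "0 \<le> B" "\<And>x. x \<in> \<Omega> \<Longrightarrow> F x = chain_len x"
    and xy: "x \<in> \<Omega>" "y \<in> \<Omega>" "dist x y \<le> 2 ^ k * min (bd \<Omega> x) (bd \<Omega> y)"
  shows "\<bar>chain_len x - chain_len y\<bar> \<le> 2 + real (2 * (k + 4 * CARD('n)) + 2) * (2 ^ CARD('n) * B)"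
proof -
  define m where "m = min (bd \<Omega> x) (bd \<Omega> y)"
  \<comment> \<open>Small enough that the cubes of half side \<open>r\<close> stay within
    \<open>m / 4\<close> of their centres, less than a third of the distance to the
    complement.\<close>
  define r where "r = m / (4 * real CARD('n))"
  have m: "0 < m" using bd_pos dom xy by (auto simp: m_def)
  then have r: "0 < r" by (simp add: r_def)
  have near: "\<bar>mean F (ccube p r) - chain_len p\<bar> \<le> 1" if p: "m \<le> bd \<Omega> p" for p
  proof -
    have in_near: "w \<in> \<Omega> \<and> \<bar>chain_len w - chain_len p\<bar> \<le> 1" if "w \<in> ccube p r" for w
    proof -
      have "dist p w \<le> m / 4" using dist_le_of_mem_ccube[OF that] by (simp add: r_def)
      then have "dist p w < bd \<Omega> p / 3" "dist p w < bd \<Omega> p" using p m by linarith+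
      then show ?thesis using hops_near less_bd_in by blast
    qed
    have "compact (ccube p r)" by (simp add: ccube_def cube_def)
    then have int: "set_integrable lebesgue (ccube p r) F" using F(1) by (auto simp: BMO_def)
    then have int': "set_integrable lebesgue (ccube p r) (\<lambda>w. \<bar>F w - chain_len p\<bar>)"
      unfolding ccube_def by (intro set_integrable_abs set_integral_diff set_integrable_const_cube)
    have "\<bar>mean F (ccube p r) - chain_len p\<bar>
        \<le> (2 * r / (2 * r)) ^ CARD('n) * mean (\<lambda>w. \<bar>F w - chain_len p\<bar>) (ccube p r)"
      using int r unfolding ccube_def by (intro abs_mean_diff_le) auto
    also have "\<dots> = mean (\<lambda>w. \<bar>F w - chain_len p\<bar>) (ccube p r)" using r by simp
    also have "\<dots> \<le> mean (\<lambda>_. 1) (ccube p r)"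
      using int' in_near F(4) r unfolding ccube_def
      by (intro mean_mono set_integrable_const_cube) auto
    also have "\<dots> = 1" using r unfolding ccube_def by (intro mean_const) simp
    finally show ?thesis .
  qed
  \<comment> \<open>Passing from the scale \<open>m\<close> to \<open>r\<close> loses the factor
    \<open>4 * n\<close>; this crude power of two absorbs it into the exponent.\<close>
  have "4 * real CARD('n) \<le> 2 ^ (4 * CARD('n))"
  proof -
    have "4 * CARD('n) \<le> 2 ^ (4 * CARD('n))" by (intro less_imp_le less_exp)
    then have "real (4 * CARD('n)) \<le> real (2 ^ (4 * CARD('n)))" by (rule of_nat_mono)
    then show ?thesis by simp
  qed
  then have "2 ^ k * (4 * real CARD('n) * r) \<le> 2 ^ k * (2 ^ (4 * CARD('n)) * r)"
    using r by (intro mult_left_mono mult_right_mono) auto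
  moreover have "4 * real CARD('n) * r = m" by (simp add: r_def)
  ultimately have "2 ^ k * m \<le> 2 ^ (k + 4 * CARD('n)) * r"
    by (simp only: power_add mult.assoc)
  then have "dist x y \<le> 2 ^ (k + 4 * CARD('n)) * r"
    using xy(3) unfolding m_def by linarith
  note mean_ccube_pair[OF F(1-3) r this]
  moreover have "m \<le> bd \<Omega> x" "m \<le> bd \<Omega> y" by (auto simp: m_def)
  ultimately show ?thesis using near[of x] near[of y] by linarith
qed

end

section \<open>Logarithmic growth from the extension property\<close>

definition fat :: "(real ^ 'n) set \<Rightarrow> real \<Rightarrow> (real ^ 'n) set" where
  "fat \<Omega> s = {z \<in> \<Omega>. s \<le> bd \<Omega> z}"

lemma fat_borel: "open \<Omega> \<Longrightarrow> fat \<Omega> s \<in> sets borel"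
proof -
  assume "open \<Omega>"
  moreover have "closed {z. s \<le> bd \<Omega> z}"
    by (intro closed_Collect_le continuous_on_bd continuous_intros)
  moreover have "fat \<Omega> s = \<Omega> \<inter> {z. s \<le> bd \<Omega> z}" by (auto simp: fat_def)
  ultimately show ?thesis by (simp add: borel_open borel_closed sets.Int)
qed

text \<open>The constant \<open>c\<close> is chosen before \<open>s\<close> and \<open>S\<close>,
  which the uniform norm bound of \<open>chain_len_bmo\<close> permits. This allows different
  targets later. It is a natural number since it bounds numbers of links.\<close>

lemma hops_diff_le_of_extension:
  fixes \<Omega> :: "(real ^ 'n) set" and lam C :: real
  assumes dom: "open \<Omega>" "connected \<Omega>" "\<Omega> \<noteq> UNIV" and C: "0 < C"
    and ext: "\<forall>f \<in> bmo lam \<Omega>. \<exists>F \<in> BMO.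
           (\<forall>x\<in>\<Omega>. F x = f x) \<and> BMO_norm F \<le> ennreal C * bmo_norm lam \<Omega> f"
  obtains c :: nat where "0 < c"
    "\<And>s S x y k. 2 * s \<le> lam \<Longrightarrow> fat \<Omega> s \<subseteq> S \<Longrightarrow> S \<subseteq> \<Omega> \<Longrightarrow> S \<noteq> {} \<Longrightarrow> S \<in> sets borel \<Longrightarrow>
      x \<in> \<Omega> \<Longrightarrow> y \<in> \<Omega> \<Longrightarrow> dist x y \<le> 2 ^ k * min (bd \<Omega> x) (bd \<Omega> y) \<Longrightarrow>
      hops \<Omega> S x \<le> hops \<Omega> S y + c * (k + 1)"
proof -
  let ?N = "real CARD('n)"
  define B where "B = C * (3 * (?N * (4 * ?N + 1)))"
  have B: "0 \<le> B" using C by (simp add: B_def)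
  define P where "P = 2 ^ CARD('n) * B"
  have P: "0 \<le> P" using B by (simp add: P_def)
  \<comment> \<open>Rounds up a constant whose product with \<open>k + 1\<close> dominates the bound
    of \<open>chain_len_diff_le\<close> for every \<open>k\<close>.\<close>
  define c where "c = nat \<lceil>2 + (8 * ?N + 2) * P\<rceil>"
  have c: "2 + (8 * ?N + 2) * P \<le> real c" unfolding c_def by linarith
  show thesis
  proof (rule that)
    have "0 \<le> (8 * ?N + 2) * P" using P by simp
    then show "0 < c" using c by linarith
  next
    fix s S x y k
    assume S: "2 * s \<le> lam" "fat \<Omega> s \<subseteq> S" "S \<subseteq> \<Omega>" "S \<noteq> {}" "S \<in> sets borel"
      and xy: "x \<in> \<Omega>" "y \<in> \<Omega>" "dist x y \<le> 2 ^ k * min (bd \<Omega> x) (bd \<Omega> y)"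
    interpret chain_target_vec \<Omega> S
      using dom S by unfold_locales
    have fat: "{z \<in> \<Omega>. s \<le> bd \<Omega> z} \<subseteq> S" using S(2) by (simp add: fat_def)
    obtain F where F: "F \<in> BMO" "\<And>x. x \<in> \<Omega> \<Longrightarrow> F x = chain_len x"
      "BMO_norm F \<le> ennreal C * bmo_norm lam \<Omega> chain_len"
      using bspec[OF ext chain_len_bmo(1)[OF S(1) fat]] by auto
    note F(3)
    also have "ennreal C * bmo_norm lam \<Omega> chain_len \<le> ennreal C * ennreal (3 * (?N * (4 * ?N + 1)))"
      by (intro mult_left_mono chain_len_bmo(2)[OF S(1) fat]) simp
    also have "\<dots> = ennreal B" using C by (simp add: B_def ennreal_mult)
    finally have "\<bar>chain_len x - chain_len y\<bar> \<le> 2 + real (2 * (k + 4 * CARD('n)) + 2) * P"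
      unfolding P_def by (rule chain_len_diff_le[OF F(1) _ B F(2) xy])
    also have "\<dots> \<le> (2 + (8 * ?N + 2) * P) * real (k + 1)"
    proof -
      have "0 \<le> real k * ((8 * ?N) * P)" using P by (intro mult_nonneg_nonneg) auto
      then show ?thesis by (simp add: algebra_simps)
    qed
    also have "\<dots> \<le> real c * real (k + 1)" using c by (intro mult_right_mono) auto
    finally have "chain_len x \<le> real (hops \<Omega> S y + c * (k + 1))"
      by (simp add: algebra_simps)
    then show "hops \<Omega> S x \<le> hops \<Omega> S y + c * (k + 1)" by (simp only: of_nat_le_iff)
  qed
qed

section \<open>Shortest chains are carrots\<close>

text \<open>Logarithms grow slower than \<open>n\<close>. In use, \<open>n\<close> links at one
  scale cover a distance of at most \<open>n\<close>, hence \<open>2 ^ k\<close>, units, while the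
  logarithmic bound allows only \<open>c * (k + 1)\<close> links; so \<open>n\<close> stays below
  \<open>P\<close>.\<close>

lemma linear_less_power2:
  fixes c :: nat
  assumes "0 < c"
  shows "\<exists>P>0. \<forall>n\<ge>P. \<exists>k. n \<le> 2 ^ k \<and> c * (k + 1) < n"
proof -
  \<comment> \<open>With this choice \<open>c * (k0 + 2) = 4 * c * (c + 1)\<close>, and
    \<open>2 * c + 3 \<le> k0\<close> because \<open>c\<close> is positive.\<close>
  define k0 where "k0 = 4 * c + 2"
  have base: "c * (k0 + 2) < 2 ^ k0"
  proof -
    have "c * (c + 1) < 2 ^ c * 2 ^ (c + 1)"
      using less_exp[of c] less_exp[of "c + 1"] by (intro mult_strict_mono) auto
    moreover have "c * (k0 + 2) = 4 * (c * (c + 1))" by (simp add: k0_def algebra_simps)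
    moreover have "(2 :: nat) ^ (2 * c + 3) = 4 * (2 ^ c * 2 ^ (c + 1))"
    proof -
      have "2 * c + 3 = 2 + (c + (c + 1))" by simp
      then show ?thesis by (simp only: power_add) simp
    qed
    ultimately have "c * (k0 + 2) < 2 ^ (2 * c + 3)" by linarith
    also have "\<dots> \<le> 2 ^ k0" using assms by (intro power_increasing) (auto simp: k0_def)
    finally show ?thesis .
  qed
  have grow: "c * (k + 2) < 2 ^ k" if "k0 \<le> k" for k
    using that
  proof (induction k rule: dec_induct)
    case (step k)
    then show ?case by (simp add: algebra_simps)
  qed (rule base)
  have "\<exists>k. n \<le> 2 ^ k \<and> c * (k + 1) < n" if n: "2 ^ k0 \<le> n" for n :: nat
  proof -
    have "1 \<le> n" using n one_le_power[of "2::nat" k0] by linarith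
    \<comment> \<open>The witness is \<open>k + 1\<close>, for which \<open>grow\<close> gives
      \<open>c * (k + 2) < 2 ^ k \<le> n\<close>.\<close>
    then obtain k where k: "2 ^ k \<le> n" "n < 2 ^ (k + 1)" using ex_power_ivl1[of 2 n] by auto
    have "(2 :: nat) ^ k0 < 2 ^ (k + 1)" using n k by linarith
    then have "k0 \<le> k" by (simp add: power_strict_increasing_iff del: power_Suc)
    from grow[OF this] k show ?thesis
      by (intro exI[of _ "k + 1"]) (simp add: algebra_simps)
  qed
  then show ?thesis by (intro exI[of _ "2 ^ k0"]) simp
qed

lemma dist_chain_le:
  fixes g :: "nat \<Rightarrow> 'a::metric_space"
  assumes "u \<le> v"
  shows "dist (g u) (g v) \<le> (\<Sum>j=u..<v. dist (g j) (g (Suc j)))"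
  using assms
proof (induction v rule: dec_induct)
  case (step v)
  then show ?case using dist_triangle[of "g u" "g (Suc v)" "g v"] by simp
qed simp

lemma bd_chain_le:
  assumes "\<And>i. i < N \<Longrightarrow> (g i, g (Suc i)) \<in> link \<Omega>" "u \<le> v" "v \<le> N"
  shows "bd \<Omega> (g v) \<le> 2 ^ (v - u) * bd \<Omega> (g u)" "bd \<Omega> (g u) \<le> 2 ^ (v - u) * bd \<Omega> (g v)"
proof -
  have "bd \<Omega> (g v) \<le> 2 ^ (v - u) * bd \<Omega> (g u) \<and> bd \<Omega> (g u) \<le> 2 ^ (v - u) * bd \<Omega> (g v)"
    using assms(2,3)
  proof (induction v rule: dec_induct)
    case (step v)
    have l: "bd \<Omega> (g (Suc v)) \<le> 2 * bd \<Omega> (g v)" "bd \<Omega> (g v) \<le> 2 * bd \<Omega> (g (Suc v))"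
      using link_bd(5,6) assms(1) step by force+
    have "2 ^ (v - u) * bd \<Omega> (g v) \<le> 2 ^ (v - u) * (2 * bd \<Omega> (g (Suc v)))"
      using l by (intro mult_left_mono) auto
    then have "bd \<Omega> (g u) \<le> 2 ^ (v - u) * (2 * bd \<Omega> (g (Suc v)))"
      using step.IH step.prems by linarith
    then show ?case using l step by (simp add: Suc_diff_le)
  qed simp
  then show "bd \<Omega> (g v) \<le> 2 ^ (v - u) * bd \<Omega> (g u)" "bd \<Omega> (g u) \<le> 2 ^ (v - u) * bd \<Omega> (g v)"
    by auto
qed

text \<open>A discrete form of the Gehring--Osgood argument: a chain whose combinatorial distances
  are logarithmic in the Euclidean ones cannot linger at one scale, so the running maximum of
  the boundary distance doubles every P steps.\<close>

lemma carrot_chain: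
  fixes c :: nat
  assumes "0 < c"
  obtains K :: real where "1 \<le> K"
    "\<And>(\<Omega> :: 'a::metric_space set) g N s i.
      \<lbrakk>\<And>i. i < N \<Longrightarrow> (g i, g (Suc i)) \<in> link \<Omega>;
       \<And>u v k. \<lbrakk>u \<le> v; v \<le> N; dist (g u) (g v) \<le> 2 ^ k * min (bd \<Omega> (g u)) (bd \<Omega> (g v))\<rbrakk>
         \<Longrightarrow> v - u \<le> c * (k + 1);
       \<And>i. i < N \<Longrightarrow> bd \<Omega> (g i) < s; s \<le> bd \<Omega> (g N); i < N\<rbrakk>
      \<Longrightarrow> (\<Sum>j\<le>i. dist (g j) (g (Suc j))) \<le> K * bd \<Omega> (g i)"
proof -
  obtain P where P: "0 < P" "\<forall>n\<ge>P. \<exists>k. n \<le> 2 ^ k \<and> c * (k + 1) < n"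
    using linear_less_power2[OF assms] by blast
  \<comment> \<open>The length before vertex \<open>i\<close> is at most \<open>2 * P * D i\<close>,
    the maximum \<open>D i\<close> at most \<open>2 ^ P * d i\<close>, and the summand 1 pays for
    the edge leaving \<open>i\<close>.\<close>
  define K where "K = 2 * real P * 2 ^ P + 1"
  show thesis
  proof (rule that)
    show "1 \<le> K" by (simp add: K_def)
  next
    fix \<Omega> :: "'a set" and g N s i
    assume link: "\<And>i. i < N \<Longrightarrow> (g i, g (Suc i)) \<in> link \<Omega>"
      and log: "\<And>u v k. \<lbrakk>u \<le> v; v \<le> N; dist (g u) (g v) \<le> 2 ^ k * min (bd \<Omega> (g u)) (bd \<Omega> (g v))\<rbrakk>
         \<Longrightarrow> v - u \<le> c * (k + 1)"
      and below: "\<And>i. i < N \<Longrightarrow> bd \<Omega> (g i) < s" and above: "s \<le> bd \<Omega> (g N)" and i: "i < N"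
    define d where "d j = bd \<Omega> (g j)" for j
    define e where "e j = dist (g j) (g (Suc j))" for j
    define D where "D j = Max (d ` {..j})" for j
    have e: "e j \<le> d j / 2" if "j < N" for j
      using link_bd(3)[OF link[OF that]] by (simp add: e_def d_def)
    have dpos: "0 < d j" if "j < N" for j
      using link_bd(1)[OF link[OF that]] by (simp add: d_def)
    have dD: "d u \<le> D j" if "u \<le> j" for u j
      unfolding D_def using that by (intro Max_ge) auto
    have D_att: "\<exists>u\<le>j. d u = D j" for j
    proof -
      have "D j \<in> d ` {..j}" unfolding D_def by (intro Max_in) auto
      then show ?thesis by auto
    qed
    have D_mono: "D u \<le> D j" if "u \<le> j" for u j
    proof -
      obtain w where "w \<le> u" "d w = D u" using D_att by blast
      then show ?thesis using dD[of w j] that by simp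
    qed
    have double: "2 * D (j - P) \<le> D j" if "P \<le> j" "j < N" for j
    proof -
      obtain u where u: "u \<le> j - P" "d u = D (j - P)" using D_att by blast
      have du: "d u < s" "0 < d u" using below[of u] dpos[of u] u that by (auto simp: d_def)
      define v where "v = (LEAST v. u \<le> v \<and> (2 * d u \<le> d v \<or> v = N))"
      have "u \<le> N" using u that by simp
      then have v: "u \<le> v" "2 * d u \<le> d v \<or> v = N" and vN: "v \<le> N"
        using LeastI[of "\<lambda>v. u \<le> v \<and> (2 * d u \<le> d v \<or> v = N)" N]
          Least_le[of "\<lambda>v. u \<le> v \<and> (2 * d u \<le> d v \<or> v = N)" N] unfolding v_def by auto
      have below_v: "d w < 2 * d u" if "u \<le> w" "w < v" for w
        using not_less_Least[of w "\<lambda>v. u \<le> v \<and> (2 * d u \<le> d v \<or> v = N)"] that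
        unfolding v_def by auto
      have "dist (g u) (g v) \<le> (\<Sum>j=u..<v. e j)"
        unfolding e_def by (rule dist_chain_le[OF v(1)])
      also have "\<dots> \<le> (\<Sum>j=u..<v. d u)"
      proof (rule sum_mono)
        fix j assume "j \<in> {u..<v}"
        then show "e j \<le> d u" using e[of j] below_v[of j] vN by simp
      qed
      also have "\<dots> = real (v - u) * d u" by simp
      finally have dist: "dist (g u) (g v) \<le> real (v - u) * d u" .
      \<comment> \<open>If \<open>v\<close> is the fallback \<open>N\<close>, this holds because
        \<open>d u < s \<le> d N\<close>.\<close>
      have "d u \<le> min (bd \<Omega> (g u)) (bd \<Omega> (g v))"
        using v(2) du above by (auto simp: d_def)
      \<comment> \<open>All edges between \<open>u\<close> and \<open>v\<close> have length at most
        \<open>d u\<close>, so with \<open>P\<close> or more of them the logarithmic bound would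
        contradict the choice of \<open>P\<close>. Hence \<open>v\<close> is not beyond
        \<open>j\<close> and the doubling has really occurred.\<close>
      moreover have "v - u < P"
      proof (rule ccontr)
        assume "\<not> v - u < P"
        then obtain k where k: "v - u \<le> 2 ^ k" "c * (k + 1) < v - u" using P(2) by (meson not_less)
        have "real (v - u) \<le> real (2 ^ k)" using k(1) by (rule of_nat_mono)
        then have "real (v - u) * d u \<le> 2 ^ k * min (bd \<Omega> (g u)) (bd \<Omega> (g v))"
          using \<open>d u \<le> min _ _\<close> du by (intro mult_mono) auto
        with dist have "v - u \<le> c * (k + 1)" by (intro log v vN) simp
        with k(2) show False by simp
      qed
      ultimately have "v \<le> j" using u that by linarith
      then have "2 * d u \<le> d v" using v(2) that by auto
      then show ?thesis using dD[OF \<open>v \<le> j\<close>] u(2) by simp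
    qed
    \<comment> \<open>Induction in blocks of \<open>P\<close> edges: doubling turns the bound for
      the earlier blocks into \<open>P * D m\<close>, and the last block adds at most
      \<open>P * D m / 2\<close>.\<close>
    have len: "(\<Sum>j<m. e j) \<le> 2 * real P * D m" if "m < N" for m
      using that
    proof (induction m rule: less_induct)
      case (less m)
      have part: "(\<Sum>j=l..<m. e j) \<le> real (m - l) * (D m / 2)" for l
      proof -
        have "(\<Sum>j=l..<m. e j) \<le> (\<Sum>j=l..<m. D m / 2)"
        proof (rule sum_mono)
          fix j assume "j \<in> {l..<m}"
          then show "e j \<le> D m / 2" using e[of j] dD[of j m] less.prems by simp
        qed
        then show ?thesis by simp
      qed
      have Dm: "0 < D m" using dD[of m m] dpos[OF less.prems] by simp
      show ?case
      proof (cases "m < P")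
        case True
        have "(\<Sum>j<m. e j) \<le> real m * (D m / 2)" using part[of 0] by (simp add: lessThan_atLeast0)
        also have "\<dots> \<le> (4 * real P) * (D m / 2)" using True Dm by (intro mult_right_mono) auto
        finally show ?thesis by (simp add: algebra_simps)
      next
        case False
        then have Pm: "P \<le> m" by simp
        have "(\<Sum>j<m. e j) = (\<Sum>j<m - P. e j) + (\<Sum>j=m - P..<m. e j)"
          unfolding lessThan_atLeast0 by (rule sum.atLeastLessThan_concat[symmetric]) auto
        also have "(\<Sum>j<m - P. e j) \<le> 2 * real P * D (m - P)"
          using less P(1) Pm by (intro less.IH) auto
        also have "2 * real P * D (m - P) = real P * (2 * D (m - P))" by simp
        also have "\<dots> \<le> real P * D m" using double[OF Pm less.prems] by (intro mult_left_mono) auto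
        also have "(\<Sum>j=m - P..<m. e j) \<le> real P * (D m / 2)" using part[of "m - P"] Pm by simp
        also have "real P * D m + real P * (D m / 2) \<le> 2 * real P * D m" using Dm by simp
        finally show ?thesis by simp
      qed
    qed
    \<comment> \<open>The maximum is attained fewer than \<open>P\<close> steps before
      \<open>i\<close>, as it would otherwise have doubled in between; each later link at most
      halves the boundary distance.\<close>
    have "D i \<le> 2 ^ P * d i"
    proof -
      obtain u where u: "u \<le> i" "d u = D i" using D_att by blast
      have "i - u < P"
      proof (rule ccontr)
        assume *: "\<not> i - u < P"
        then have "P \<le> i" "u \<le> i - P" using u by auto
        then have "2 * d u \<le> d u" using double[of i] i dD[of u "i - P"] u by simp
        then show False using dpos[of u] u i by simp
      qed
      have "d u \<le> 2 ^ (i - u) * d i"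
        unfolding d_def using u i link by (intro bd_chain_le(2)[where N = N and g = g]) auto
      also have "\<dots> \<le> 2 ^ P * d i"
        using \<open>i - u < P\<close> dpos[OF i] by (intro mult_right_mono power_increasing) auto
      finally show ?thesis using u by simp
    qed
    have "(\<Sum>j\<le>i. e j) = (\<Sum>j<i. e j) + e i" by (simp add: lessThan_Suc_atMost[symmetric])
    also have "\<dots> \<le> 2 * real P * D i + d i" using len[OF i] e[OF i] dpos[OF i] by simp
    also have "\<dots> \<le> 2 * real P * (2 ^ P * d i) + d i"
      using \<open>D i \<le> 2 ^ P * d i\<close> by (intro add_mono mult_left_mono) auto
    also have "\<dots> = K * d i" by (simp add: K_def algebra_simps)
    finally show "(\<Sum>j\<le>i. dist (g j) (g (Suc j))) \<le> K * bd \<Omega> (g i)"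
      by (simp add: d_def e_def)
  qed
qed

section \<open>From chains to curves\<close>

definition clamp01 :: "real \<Rightarrow> real" where
  "clamp01 x = max 0 (min 1 x)"

lemma clamp01_mono: "x \<le> y \<Longrightarrow> clamp01 x \<le> clamp01 y"
  by (auto simp: clamp01_def)

lemma clamp01_bounds: "0 \<le> clamp01 x" "clamp01 x \<le> 1"
  by (auto simp: clamp01_def)

text \<open>\<open>\<Lambda>\<close> acts as a length function dominating the increments of the
  curve; over any partition these bounds telescope.\<close>

lemma arclength_subpath_le:
  assumes "\<And>s t. 0 \<le> s \<Longrightarrow> s \<le> t \<Longrightarrow> t \<le> 1 \<Longrightarrow> dist (\<gamma> s) (\<gamma> t) \<le> \<Lambda> t - \<Lambda> s"
    and "0 \<le> u" "u \<le> v" "v \<le> 1"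
  shows "arclength (subpath u v \<gamma>) \<le> ennreal (\<Lambda> v - \<Lambda> u)"
  unfolding arclength_def
proof (rule SUP_least, clarify)
  fix m and t :: "nat \<Rightarrow> real"
  assume t: "t 0 = 0" "t m = 1" "\<forall>i<m. t i \<le> t (Suc i)"
  have mono: "t i \<le> t j" if "i \<le> j" "j \<le> m" for i j
    using that
  proof (induction j rule: dec_induct)
    case (step k)
    then have "t i \<le> t k" "t k \<le> t (Suc k)" using t(3) by auto
    then show ?case by (rule order_trans)
  qed simp
  define p where "p i = (v - u) * t i + u" for i
  have p: "0 \<le> p i" "p i \<le> p (Suc i)" "p (Suc i) \<le> 1" if "i < m" for i
  proof -
    have "0 \<le> t i" using mono[of 0 i] t that by simp
    then show "0 \<le> p i" using assms by (simp add: p_def)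
    show "p i \<le> p (Suc i)"
      unfolding p_def using assms t(3) that by (intro add_mono mult_left_mono) auto
    have "t (Suc i) \<le> 1" using mono[of "Suc i" m] t that by simp
    then have "(v - u) * t (Suc i) \<le> (v - u) * 1" using assms by (intro mult_left_mono) auto
    then show "p (Suc i) \<le> 1" using assms by (simp add: p_def)
  qed
  have "(\<Sum>i<m. dist (subpath u v \<gamma> (t i)) (subpath u v \<gamma> (t (Suc i))))
      \<le> (\<Sum>i<m. \<Lambda> (p (Suc i)) - \<Lambda> (p i))"
    using assms(1) p by (intro sum_mono) (simp add: subpath_def p_def)
  also have "\<dots> = \<Lambda> v - \<Lambda> u"
    using sum_lessThan_telescope[of "\<lambda>i. \<Lambda> (p i)" m] t by (simp add: p_def)
  finally show "ennreal (\<Sum>i<m. dist (subpath u v \<gamma> (t i)) (subpath u v \<gamma> (t (Suc i))))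
      \<le> ennreal (\<Lambda> v - \<Lambda> u)"
    by (rule ennreal_leI)
qed

lemma sum_lessThan_split_at:
  fixes h :: "nat \<Rightarrow> 'b::comm_monoid_add"
  assumes "i < N"
  shows "sum h {..<N} = sum h {..<i} + h i + sum h {Suc i..<N}"
proof -
  have "sum h {..<N} = sum h {0..<Suc i} + sum h {Suc i..<N}"
    using assms by (subst sum.atLeastLessThan_concat) (auto simp: lessThan_atLeast0)
  then show ?thesis by (simp add: lessThan_atLeast0)
qed

text \<open>The portion of the polygon up to a point of its i-th edge is estimated by the whole
  edges 0, ..., i, and the remaining portion by the edges i, ..., N - 1.\<close>

lemma polygonal_curve:
  fixes p :: "nat \<Rightarrow> 'a::real_normed_vector"
  assumes N: "0 < N"
  obtains \<gamma> where "path \<gamma>" "pathstart \<gamma> = p 0" "pathfinish \<gamma> = p N"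
    "arclength \<gamma> \<le> ennreal (\<Sum>j<N. dist (p j) (p (Suc j)))"
    "\<And>u. u \<in> {0..1} \<Longrightarrow> \<exists>i<N. \<gamma> u \<in> closed_segment (p i) (p (Suc i)) \<and>
        arclength (subpath 0 u \<gamma>) \<le> ennreal (\<Sum>j\<le>i. dist (p j) (p (Suc j))) \<and>
        arclength (subpath u 1 \<gamma>) \<le> ennreal (\<Sum>j=i..<N. dist (p j) (p (Suc j)))"
proof -
  \<comment> \<open>Fraction of edge \<open>i\<close> traversed at time \<open>u\<close>. Summing
    over all edges gives one closed formula for the polygon, so continuity needs no gluing.\<close>
  define c where "c u i = clamp01 (real N * u - real i)" for u i
  define \<gamma> where "\<gamma> u = p 0 + (\<Sum>j<N. c u j *\<^sub>R (p (Suc j) - p j))" for u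
  define \<Lambda> where "\<Lambda> u = (\<Sum>j<N. c u j * dist (p j) (p (Suc j)))" for u
  have c_mono: "c s i \<le> c t i" if "s \<le> t" for s t i
    unfolding c_def using that by (intro clamp01_mono diff_mono mult_left_mono) auto
  have c01: "0 \<le> c u i" "c u i \<le> 1" for u i
    using clamp01_bounds by (auto simp: c_def)
  have lip: "dist (\<gamma> s) (\<gamma> t) \<le> \<Lambda> t - \<Lambda> s" if "s \<le> t" for s t
  proof -
    have "\<gamma> s - \<gamma> t = (\<Sum>j<N. (c s j - c t j) *\<^sub>R (p (Suc j) - p j))"
      by (simp add: \<gamma>_def sum_subtractf scaleR_diff_left)
    then have "norm (\<gamma> s - \<gamma> t) \<le> (\<Sum>j<N. norm ((c s j - c t j) *\<^sub>R (p (Suc j) - p j)))"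
      by (metis norm_sum)
    also have "\<dots> = (\<Sum>j<N. c t j * dist (p j) (p (Suc j)) - c s j * dist (p j) (p (Suc j)))"
    proof (intro sum.cong refl)
      fix j
      have "\<bar>c s j - c t j\<bar> = c t j - c s j" using c_mono[OF that, of j] by simp
      then show "norm ((c s j - c t j) *\<^sub>R (p (Suc j) - p j)) =
          c t j * dist (p j) (p (Suc j)) - c s j * dist (p j) (p (Suc j))"
        by (simp add: dist_norm norm_minus_commute left_diff_distrib)
    qed
    also have "\<dots> = \<Lambda> t - \<Lambda> s" by (simp add: \<Lambda>_def sum_subtractf)
    finally show ?thesis by (simp add: dist_norm)
  qed
  have c_0: "c u j = 0" if "real N * u \<le> real j" for u j
    using that by (simp add: c_def clamp01_def)
  have c_1: "c u j = 1" if "real (Suc j) \<le> real N * u" for u j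
    using that by (simp add: c_def clamp01_def)
  have tele: "p 0 + (\<Sum>j<i. p (Suc j) - p j) = p i" for i
    by (simp add: sum_lessThan_telescope)
  have \<Lambda>0: "\<Lambda> 0 = 0" by (simp add: \<Lambda>_def c_0)
  have \<Lambda>1: "\<Lambda> 1 = (\<Sum>j<N. dist (p j) (p (Suc j)))"
    unfolding \<Lambda>_def by (intro sum.cong refl) (subst c_1, auto)
  have len: "arclength (subpath u v \<gamma>) \<le> ennreal (\<Lambda> v - \<Lambda> u)" if "0 \<le> u" "u \<le> v" "v \<le> 1" for u v
    using lip that by (intro arclength_subpath_le) auto
  show thesis
  proof (rule that)
    show "path \<gamma>"
      unfolding path_def \<gamma>_def c_def clamp01_def by (intro continuous_intros)
    show "pathstart \<gamma> = p 0"
      by (simp add: pathstart_def \<gamma>_def c_0)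
    have "\<gamma> 1 = p 0 + (\<Sum>j<N. p (Suc j) - p j)"
      unfolding \<gamma>_def by (intro arg_cong2[where f = plus] sum.cong refl) (subst c_1, auto)
    then show "pathfinish \<gamma> = p N" by (simp add: pathfinish_def tele)
    show "arclength \<gamma> \<le> ennreal (\<Sum>j<N. dist (p j) (p (Suc j)))"
      using len[of 0 1] by (simp add: \<Lambda>0 \<Lambda>1 subpath_trivial)
  next
    fix u :: real assume u: "u \<in> {0..1}"
    \<comment> \<open>At \<open>u = 1\<close> the floor would be \<open>N\<close>, which indexes no
      edge.\<close>
    define i where "i = (if u = 1 then N - 1 else nat \<lfloor>real N * u\<rfloor>)"
    have i: "i < N" "real i \<le> real N * u" "real N * u \<le> real (Suc i)"
    proof -
      have "real N * u < real N" if "u \<noteq> 1" using u that N by auto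
      moreover have "0 \<le> real N * u" using u by auto
      ultimately show "i < N" "real i \<le> real N * u" "real N * u \<le> real (Suc i)"
        using N by (auto simp: i_def nat_less_iff floor_less_iff of_nat_nat) linarith+
    qed
    note split = sum_lessThan_split_at[OF i(1)]
    have "\<gamma> u = p 0 + ((\<Sum>j<i. p (Suc j) - p j) + c u i *\<^sub>R (p (Suc i) - p i))"
    proof -
      have "(\<Sum>j<i. c u j *\<^sub>R (p (Suc j) - p j)) = (\<Sum>j<i. p (Suc j) - p j)"
        using i by (intro sum.cong refl) (subst c_1, auto)
      moreover have "(\<Sum>j=Suc i..<N. c u j *\<^sub>R (p (Suc j) - p j)) = 0"
        using i by (intro sum.neutral ballI) (subst c_0, auto)
      ultimately show ?thesis unfolding \<gamma>_def split by simp
    qed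
    then have "\<gamma> u = p i + c u i *\<^sub>R (p (Suc i) - p i)"
      using tele[of i] by (simp add: add.assoc[symmetric])
    then have "\<gamma> u \<in> closed_segment (p i) (p (Suc i))"
      using c01[of u i] by (auto simp: in_segment algebra_simps intro!: exI[of _ "c u i"])
    moreover have "\<Lambda> u \<le> (\<Sum>j\<le>i. dist (p j) (p (Suc j)))"
    proof -
      have "(\<Sum>j=Suc i..<N. c u j * dist (p j) (p (Suc j))) = 0"
        using i by (intro sum.neutral ballI) (subst c_0, auto)
      then have "\<Lambda> u = (\<Sum>j\<le>i. c u j * dist (p j) (p (Suc j)))"
        unfolding \<Lambda>_def split by (simp add: lessThan_Suc_atMost[symmetric])
      also have "\<dots> \<le> (\<Sum>j\<le>i. dist (p j) (p (Suc j)))"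
        using c01 by (intro sum_mono mult_left_le_one_le) auto
      finally show ?thesis .
    qed
    moreover have "\<Lambda> 1 - \<Lambda> u \<le> (\<Sum>j=i..<N. dist (p j) (p (Suc j)))"
    proof -
      have "\<Lambda> u \<ge> (\<Sum>j<i. c u j * dist (p j) (p (Suc j)))"
        unfolding \<Lambda>_def using i c01 by (intro sum_mono2) auto
      also have "(\<Sum>j<i. c u j * dist (p j) (p (Suc j))) = (\<Sum>j<i. dist (p j) (p (Suc j)))"
        using i by (intro sum.cong refl) (subst c_1, auto)
      finally show ?thesis
        using i unfolding \<Lambda>1 split by (simp add: sum.atLeast_Suc_lessThan)
    qed
    moreover have "arclength (subpath 0 u \<gamma>) \<le> ennreal (\<Lambda> u)"
      "arclength (subpath u 1 \<gamma>) \<le> ennreal (\<Lambda> 1 - \<Lambda> u)"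
      using len[of 0 u] len[of u 1] u by (auto simp: \<Lambda>0)
    ultimately show "\<exists>i<N. \<gamma> u \<in> closed_segment (p i) (p (Suc i)) \<and>
        arclength (subpath 0 u \<gamma>) \<le> ennreal (\<Sum>j\<le>i. dist (p j) (p (Suc j))) \<and>
        arclength (subpath u 1 \<gamma>) \<le> ennreal (\<Sum>j=i..<N. dist (p j) (p (Suc j)))"
      using i(1) by (meson ennreal_leI order_trans)
  qed
qed

section \<open>The cone condition along polygons\<close>

lemma bd_le_infdist_frontier:
  fixes \<Omega> :: "'a::euclidean_space set"
  assumes "open \<Omega>" "\<Omega> \<noteq> UNIV" "z \<in> \<Omega>"
  shows "bd \<Omega> z \<le> infdist z (frontier \<Omega>)"
proof -
  have "frontier \<Omega> \<noteq> {}" using assms by (auto simp: frontier_eq_empty)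
  moreover have "frontier \<Omega> \<subseteq> - \<Omega>" using assms(1) by (auto simp: frontier_def interior_open)
  ultimately show ?thesis unfolding bd_def by (intro infdist_mono)
qed

text \<open>An edge has at most half the length of the boundary distance at its first vertex, so it
  stays in the domain and that distance at most halves along it. The constant \<open>b / 2\<close>
  at vertices thus becomes \<open>b\<close> on edges.\<close>

lemma uniform_curve_of_chain:
  fixes \<Omega> :: "'a::euclidean_space set"
  assumes dom: "open \<Omega>" "\<Omega> \<noteq> UNIV" and T: "0 < T" and b: "0 \<le> b"
    and step: "\<And>i. i < T \<Longrightarrow> p i \<in> \<Omega> \<and> dist (p i) (p (Suc i)) \<le> bd \<Omega> (p i) / 2"
    and len: "(\<Sum>j<T. dist (p j) (p (Suc j))) \<le> L"
    and carrot: "\<And>i. i < T \<Longrightarrow> min (\<Sum>j\<le>i. dist (p j) (p (Suc j)))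
        (\<Sum>j=i..<T. dist (p j) (p (Suc j))) \<le> b / 2 * bd \<Omega> (p i)"
  shows "\<exists>\<gamma>. rectifiable \<gamma> \<and> path_image \<gamma> \<subseteq> \<Omega> \<and> pathstart \<gamma> = p 0 \<and> pathfinish \<gamma> = p T \<and>
           arclength \<gamma> \<le> ennreal L \<and>
           (\<forall>u\<in>{0..1}. min (arclength (subpath 0 u \<gamma>)) (arclength (subpath u 1 \<gamma>))
              \<le> ennreal b * bdist \<Omega> (\<gamma> u))"
proof -
  obtain \<gamma> where \<gamma>: "path \<gamma>" "pathstart \<gamma> = p 0" "pathfinish \<gamma> = p T"
    "arclength \<gamma> \<le> ennreal (\<Sum>j<T. dist (p j) (p (Suc j)))"
    and at: "\<And>u. u \<in> {0..1} \<Longrightarrow> \<exists>i<T. \<gamma> u \<in> closed_segment (p i) (p (Suc i)) \<and>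
        arclength (subpath 0 u \<gamma>) \<le> ennreal (\<Sum>j\<le>i. dist (p j) (p (Suc j))) \<and>
        arclength (subpath u 1 \<gamma>) \<le> ennreal (\<Sum>j=i..<T. dist (p j) (p (Suc j)))"
    using polygonal_curve[OF T, of p] by blast
  have seg: "z \<in> \<Omega> \<and> bd \<Omega> (p i) / 2 \<le> bd \<Omega> z"
    if "i < T" "z \<in> closed_segment (p i) (p (Suc i))" for i z
  proof -
    have "dist (p i) z \<le> dist (p i) (p (Suc i))"
      using segment_bound(1)[OF that(2)] by (simp add: dist_norm norm_minus_commute)
    then have d: "dist (p i) z \<le> bd \<Omega> (p i) / 2" using step[OF that(1)] by linarith
    have "0 < bd \<Omega> (p i)" using step[OF that(1)] dom by (intro bd_pos) auto
    then have "dist (p i) z < bd \<Omega> (p i)" using d by linarith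
    then have "z \<in> \<Omega>" by (rule less_bd_in)
    moreover have "bd \<Omega> (p i) / 2 \<le> bd \<Omega> z" using bd_lipschitz[of \<Omega> "p i" z] d by linarith
    ultimately show ?thesis by simp
  qed
  have len': "arclength \<gamma> \<le> ennreal L" using \<gamma>(4) len by (meson ennreal_leI order_trans)
  then have "arclength \<gamma> < \<infinity>" using le_less_trans[OF _ ennreal_less_top] by auto
  then have "rectifiable \<gamma>" using \<gamma>(1) by (simp add: rectifiable_def)
  moreover have "path_image \<gamma> \<subseteq> \<Omega>" unfolding path_image_def using at seg by blast
  moreover have "min (arclength (subpath 0 u \<gamma>)) (arclength (subpath u 1 \<gamma>)) \<le> ennreal b * bdist \<Omega> (\<gamma> u)"
    if u: "u \<in> {0..1}" for u
  proof -
    obtain i where i: "i < T" "\<gamma> u \<in> closed_segment (p i) (p (Suc i))"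
        "arclength (subpath 0 u \<gamma>) \<le> ennreal (\<Sum>j\<le>i. dist (p j) (p (Suc j)))"
        "arclength (subpath u 1 \<gamma>) \<le> ennreal (\<Sum>j=i..<T. dist (p j) (p (Suc j)))"
      using at[OF u] by blast
    have in\<Omega>: "\<gamma> u \<in> \<Omega>" "bd \<Omega> (p i) / 2 \<le> bd \<Omega> (\<gamma> u)" using seg[OF i(1,2)] by auto
    have "min (arclength (subpath 0 u \<gamma>)) (arclength (subpath u 1 \<gamma>))
        \<le> min (ennreal (\<Sum>j\<le>i. dist (p j) (p (Suc j)))) (ennreal (\<Sum>j=i..<T. dist (p j) (p (Suc j))))"
      using i(3,4) by (rule min.mono)
    also have "\<dots> = ennreal (min (\<Sum>j\<le>i. dist (p j) (p (Suc j))) (\<Sum>j=i..<T. dist (p j) (p (Suc j))))"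
      by (auto simp: min_def ennreal_le_iff sum_nonneg)
    also have "\<dots> \<le> ennreal (b * infdist (\<gamma> u) (frontier \<Omega>))"
    proof (rule ennreal_leI)
      have "min (\<Sum>j\<le>i. dist (p j) (p (Suc j))) (\<Sum>j=i..<T. dist (p j) (p (Suc j)))
          \<le> b * (bd \<Omega> (p i) / 2)" using carrot[OF i(1)] by simp
      also have "\<dots> \<le> b * infdist (\<gamma> u) (frontier \<Omega>)"
        using in\<Omega> bd_le_infdist_frontier[OF dom in\<Omega>(1)] b by (intro mult_left_mono) auto
      finally show "min (\<Sum>j\<le>i. dist (p j) (p (Suc j))) (\<Sum>j=i..<T. dist (p j) (p (Suc j)))
          \<le> b * infdist (\<gamma> u) (frontier \<Omega>)" .
    qed
    also have "\<dots> = ennreal b * bdist \<Omega> (\<gamma> u)"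
      using dom b by (simp add: bdist_def ennreal_mult infdist_nonneg)
    finally show ?thesis .
  qed
  ultimately show ?thesis using \<gamma>(2,3) len' by blast
qed

text \<open>The straight segment works, as the boundary distance is infinite by convention.\<close>

lemma locally_uniform_UNIV: "locally_uniform (UNIV :: 'a::euclidean_space set)"
  unfolding locally_uniform_def
proof (intro exI[of _ 1] conjI ballI impI)
  fix x y :: 'a
  obtain \<gamma> where \<gamma>: "path \<gamma>" "pathstart \<gamma> = (if 0 = (0::nat) then x else y)"
    "pathfinish \<gamma> = (if 1 = (0::nat) then x else y)"
    "arclength \<gamma> \<le> ennreal (\<Sum>j<1::nat. dist (if j = 0 then x else y) (if Suc j = 0 then x else y))"
    by (rule polygonal_curve[of 1 "\<lambda>j. if j = 0 then x else y"]) auto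
  have "arclength \<gamma> < \<infinity>" using le_less_trans[OF \<gamma>(4) ennreal_less_top] by simp
  moreover have "ennreal 1 * bdist UNIV (\<gamma> u) = \<infinity>" for u by (simp add: bdist_def)
  ultimately show "\<exists>\<gamma>. rectifiable \<gamma> \<and> path_image \<gamma> \<subseteq> UNIV \<and> pathstart \<gamma> = x \<and> pathfinish \<gamma> = y \<and>
      arclength \<gamma> \<le> ennreal (1 * dist x y) \<and>
      (\<forall>u\<in>{0..1}. min (arclength (subpath 0 u \<gamma>)) (arclength (subpath u 1 \<gamma>))
         \<le> ennreal 1 * bdist UNIV (\<gamma> u))"
    using \<gamma> by (intro exI[of _ \<gamma>]) (simp add: rectifiable_def)
qed auto

section \<open>Gluing two carrots\<close>

lemma sum_dist_rev:
  fixes g :: "nat \<Rightarrow> 'a::metric_space"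
  assumes "i \<le> T"
  shows "(\<Sum>j=i..<T. dist (g (T - j)) (g (T - Suc j))) = (\<Sum>j<T - i. dist (g j) (g (Suc j)))"
  using assms
  by (intro sum.reindex_bij_witness[of _ "\<lambda>j. T - Suc j" "\<lambda>j. T - Suc j"])
    (auto simp: Suc_diff_Suc dist_commute)

text \<open>Follow \<open>g\<close>, then \<open>h\<close>, then \<open>g'\<close> backwards. The
  carrot bounds serve the outer pieces; on the middle one the boundary distance is at least
  \<open>t\<close>, and the total length is at most \<open>b / 2 * t\<close>.\<close>

lemma uniform_curve_of_carrots:
  fixes \<Omega> :: "'a::euclidean_space set" and g h g' :: "nat \<Rightarrow> 'a"
  assumes dom: "open \<Omega>" "\<Omega> \<noteq> UNIV" and K: "0 \<le> K" and t: "0 < t"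
    and g: "\<And>i. i < N \<Longrightarrow> (g i, g (Suc i)) \<in> link \<Omega>"
      "\<And>i. i < N \<Longrightarrow> (\<Sum>j\<le>i. dist (g j) (g (Suc j))) \<le> K * bd \<Omega> (g i)"
    and h: "\<And>i. i < M \<Longrightarrow> (h i, h (Suc i)) \<in> link \<Omega>" "\<And>i. i < M \<Longrightarrow> t \<le> bd \<Omega> (h i)"
    and g': "\<And>i. i < N' \<Longrightarrow> (g' i, g' (Suc i)) \<in> link \<Omega>"
      "\<And>i. i < N' \<Longrightarrow> (\<Sum>j\<le>i. dist (g' j) (g' (Suc j))) \<le> K * bd \<Omega> (g' i)"
    and glue: "g N = h 0" "h M = g' N'" and N: "0 < N"
    and L: "(\<Sum>j<N. dist (g j) (g (Suc j))) + (\<Sum>j<M. dist (h j) (h (Suc j)))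
      + (\<Sum>j<N'. dist (g' j) (g' (Suc j))) \<le> L"
    and b: "4 * K \<le> b" "2 * L \<le> b * t"
  shows "\<exists>\<gamma>. rectifiable \<gamma> \<and> path_image \<gamma> \<subseteq> \<Omega> \<and> pathstart \<gamma> = g 0 \<and> pathfinish \<gamma> = g' 0 \<and>
           arclength \<gamma> \<le> ennreal L \<and>
           (\<forall>u\<in>{0..1}. min (arclength (subpath 0 u \<gamma>)) (arclength (subpath u 1 \<gamma>))
              \<le> ennreal b * bdist \<Omega> (\<gamma> u))"
proof -
  define T where "T = N + M + N'"
  define p where "p i = (if i < N then g i else if i < N + M then h (i - N) else g' (T - i))" for i
  define e where "e j = dist (p j) (p (Suc j))" for j
  \<comment> \<open>At \<open>i = N\<close> the definition of \<open>p\<close> already selects the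
    next piece, skipping \<open>h\<close> if it is empty; the gluing equations identify the
    values.\<close>
  have p1: "p i = g i" if "i \<le> N" for i
    using that glue by (cases "M = 0") (auto simp: p_def T_def)
  have p2: "p i = h (i - N)" if "N \<le> i" "i \<le> N + M" for i
    using that glue by (cases "i = N + M") (auto simp: p_def T_def)
  have p3: "p i = g' (T - i)" if "N + M \<le> i" for i
    using that by (auto simp: p_def)
  have links: "(p i, p (Suc i)) \<in> link \<Omega>" if "i < T" for i
  proof -
    consider "i < N" | "N \<le> i" "i < N + M" | "N + M \<le> i" by linarith
    then show ?thesis
    proof cases
      case 1
      then show ?thesis using g(1) p1 by simp
    next
      case 2
      then show ?thesis using h(1)[of "i - N"] p2[of i] p2[of "Suc i"] by (simp add: Suc_diff_le)
    next
      case 3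
      then show ?thesis
        using link_sym[OF g'(1)[of "T - Suc i"]] that p3[of i] p3[of "Suc i"]
        by (simp add: Suc_diff_Suc T_def)
    qed
  qed
  have e1: "e j = dist (g j) (g (Suc j))" if "j < N" for j
    using that p1 by (simp add: e_def)
  have e2: "e (j + N) = dist (h j) (h (Suc j))" if "j < M" for j
    using that p2[of "j + N"] p2[of "Suc (j + N)"] by (simp add: e_def)
  have e3: "(\<Sum>j=i..<T. e j) = (\<Sum>j<T - i. dist (g' j) (g' (Suc j)))" if "N + M \<le> i" "i \<le> T" for i
    using that p3 unfolding e_def sum_dist_rev[OF that(2), symmetric] by (intro sum.cong) auto
  have total: "(\<Sum>j<T. e j) \<le> L"
  proof -
    have "(\<Sum>j<T. e j) = (\<Sum>j=0..<N. e j) + (\<Sum>j=N..<N + M. e j) + (\<Sum>j=N + M..<T. e j)"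
      by (simp add: T_def lessThan_atLeast0 sum.atLeastLessThan_concat)
    also have "(\<Sum>j=0..<N. e j) = (\<Sum>j<N. dist (g j) (g (Suc j)))"
      by (simp add: e1 lessThan_atLeast0)
    also have "(\<Sum>j=N..<N + M. e j) = (\<Sum>j<M. dist (h j) (h (Suc j)))"
      using sum.shift_bounds_nat_ivl[of e 0 N M] by (simp add: e2 lessThan_atLeast0 add.commute)
    also have "(\<Sum>j=N + M..<T. e j) = (\<Sum>j<N'. dist (g' j) (g' (Suc j)))"
      by (subst e3) (auto simp: T_def)
    finally show ?thesis using L by simp
  qed
  have e_nonneg: "0 \<le> e j" for j by (simp add: e_def)
  have K_b: "K * d \<le> b / 2 * d" "K * d \<le> b / 2 * (d / 2)" if "0 \<le> d" for d
  proof -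
    have "K * d * 4 \<le> b * d" using mult_right_mono[OF b(1) that] by (simp add: algebra_simps)
    moreover have "0 \<le> K * d" using K that by simp
    ultimately show "K * d \<le> b / 2 * d" "K * d \<le> b / 2 * (d / 2)" by auto
  qed
  have carrot: "min (\<Sum>j\<le>i. e j) (\<Sum>j=i..<T. e j) \<le> b / 2 * bd \<Omega> (p i)" if i: "i < T" for i
  proof -
    consider "i < N" | "N \<le> i" "i < N + M" | "N + M \<le> i" by linarith
    then show ?thesis
    proof cases
      case 1
      then have "(\<Sum>j\<le>i. e j) = (\<Sum>j\<le>i. dist (g j) (g (Suc j)))"
        by (intro sum.cong) (auto simp: e1)
      also have "\<dots> \<le> K * bd \<Omega> (p i)" using g(2) 1 p1 by simp
      also have "\<dots> \<le> b / 2 * bd \<Omega> (p i)" by (intro K_b bd_nonneg)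
      finally show ?thesis by simp
    next
      case 2
      have "(\<Sum>j\<le>i. e j) \<le> (\<Sum>j<T. e j)" using i e_nonneg by (intro sum_mono2) auto
      also have "\<dots> \<le> L" by (rule total)
      also have "L \<le> b / 2 * t" using b(2) by simp
      also have "\<dots> \<le> b / 2 * bd \<Omega> (p i)"
        using h(2)[of "i - N"] 2 p2[of i] K b(1) by (intro mult_left_mono) auto
      finally show ?thesis by simp
    next
      case 3
      \<comment> \<open>The remaining edges are the edges 0 to \<open>j\<close> of
        \<open>g'\<close>, but traversed backwards, so that \<open>p i\<close> is the far end
        \<open>g' (Suc j)\<close> of edge \<open>j\<close>.\<close>
      define j where "j = T - Suc i"
      have j: "j < N'" "T - i = Suc j" using 3 i by (auto simp: j_def T_def)
      have "(\<Sum>j=i..<T. e j) = (\<Sum>l\<le>j. dist (g' l) (g' (Suc l)))"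
        using e3[OF 3] i j by (simp add: lessThan_Suc_atMost)
      also have "\<dots> \<le> K * bd \<Omega> (g' j)" by (rule g'(2)[OF j(1)])
      also have "\<dots> \<le> b / 2 * (bd \<Omega> (g' j) / 2)" by (intro K_b bd_nonneg)
      \<comment> \<open>Passing from \<open>g' j\<close> to the other end of its link may halve the
        boundary distance; this is why \<open>b\<close> has to be at least
        \<open>4 * K\<close>.\<close>
      also have "\<dots> \<le> b / 2 * bd \<Omega> (g' (Suc j))"
        using link_bd(6)[OF g'(1)[OF j(1)]] K b(1) by (intro mult_left_mono) auto
      also have "g' (Suc j) = p i" using p3[OF 3] j by simp
      finally show ?thesis by simp
    qed
  qed
  have "\<exists>\<gamma>. rectifiable \<gamma> \<and> path_image \<gamma> \<subseteq> \<Omega> \<and> pathstart \<gamma> = p 0 \<and> pathfinish \<gamma> = p T \<and>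
           arclength \<gamma> \<le> ennreal L \<and>
           (\<forall>u\<in>{0..1}. min (arclength (subpath 0 u \<gamma>)) (arclength (subpath u 1 \<gamma>))
              \<le> ennreal b * bdist \<Omega> (\<gamma> u))"
  proof (rule uniform_curve_of_chain[OF dom])
    show "0 < T" using N by (simp add: T_def)
    show "0 \<le> b" using K b(1) by simp
    show "p i \<in> \<Omega> \<and> dist (p i) (p (Suc i)) \<le> bd \<Omega> (p i) / 2" if "i < T" for i
      using link_bd[OF links[OF that]] bd_pos_in[of \<Omega> "p i"] by auto
    show "(\<Sum>j<T. dist (p j) (p (Suc j))) \<le> L" using total by (simp add: e_def)
    show "min (\<Sum>j\<le>i. dist (p j) (p (Suc j))) (\<Sum>j=i..<T. dist (p j) (p (Suc j)))
        \<le> b / 2 * bd \<Omega> (p i)" if "i < T" for i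
      using carrot[OF that] by (simp add: e_def)
  qed
  then show ?thesis using p1[of 0] p3[of T] by (simp add: T_def)
qed

section \<open>The uniform curve\<close>

text \<open>The extension property enters only through the logarithmic bound \<open>hops\<close>,
  used for two kinds of targets: in \<open>to_fat\<close> and, with a nearby point added, in
  \<open>middle\<close>.\<close>

lemma locally_uniform_of_hops_bound:
  fixes \<Omega> :: "(real ^ 'n) set" and lam :: real and c :: nat
  assumes dom: "open \<Omega>" "connected \<Omega>" "\<Omega> \<noteq> UNIV" "\<Omega> \<noteq> {}" and lam: "0 < lam" and c: "0 < c"
    and hops: "\<And>s S x y k. 2 * s \<le> lam \<Longrightarrow> fat \<Omega> s \<subseteq> S \<Longrightarrow> S \<subseteq> \<Omega> \<Longrightarrow> S \<noteq> {} \<Longrightarrow> S \<in> sets borel \<Longrightarrow>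
      x \<in> \<Omega> \<Longrightarrow> y \<in> \<Omega> \<Longrightarrow> dist x y \<le> 2 ^ k * min (bd \<Omega> x) (bd \<Omega> y) \<Longrightarrow>
      hops \<Omega> S x \<le> hops \<Omega> S y + c * (k + 1)"
  shows "locally_uniform \<Omega>"
proof -
  obtain K :: real where K: "1 \<le> K" and carrot: "\<And>(\<Omega> :: (real ^ 'n) set) g N s i.
      \<lbrakk>\<And>i. i < N \<Longrightarrow> (g i, g (Suc i)) \<in> link \<Omega>;
       \<And>u v k. \<lbrakk>u \<le> v; v \<le> N; dist (g u) (g v) \<le> 2 ^ k * min (bd \<Omega> (g u)) (bd \<Omega> (g v))\<rbrakk>
         \<Longrightarrow> v - u \<le> c * (k + 1);
       \<And>i. i < N \<Longrightarrow> bd \<Omega> (g i) < s; s \<le> bd \<Omega> (g N); i < N\<rbrakk>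
      \<Longrightarrow> (\<Sum>j\<le>i. dist (g j) (g (Suc j))) \<le> K * bd \<Omega> (g i)"
    using carrot_chain[OF c, where 'a = "real ^ 'n"] by blast
  have to_fat: "\<exists>g N. g 0 = x \<and> 0 < N \<and> (\<forall>i<N. (g i, g (Suc i)) \<in> link \<Omega>) \<and>
      (\<forall>i<N. (\<Sum>j\<le>i. dist (g j) (g (Suc j))) \<le> K * bd \<Omega> (g i)) \<and>
      s \<le> bd \<Omega> (g N) \<and> bd \<Omega> (g N) \<le> 2 * s \<and> g N \<in> \<Omega> \<and>
      (\<Sum>j<N. dist (g j) (g (Suc j))) \<le> K * s"
    if x: "x \<in> \<Omega>" "bd \<Omega> x < s" and s: "2 * s \<le> lam" "fat \<Omega> s \<noteq> {}" for x s
  proof -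
    have sub: "fat \<Omega> s \<subseteq> \<Omega>" by (auto simp: fat_def)
    interpret chain_target \<Omega> "fat \<Omega> s"
      using dom s sub by unfold_locales
    let ?N = "hops \<Omega> (fat \<Omega> s) x"
    obtain g where g: "g 0 = x" "g ?N \<in> fat \<Omega> s"
      "\<And>i. i < ?N \<Longrightarrow> (g i, g (Suc i)) \<in> link \<Omega>"
      "\<And>i. i \<le> ?N \<Longrightarrow> hops \<Omega> (fat \<Omega> s) (g i) = ?N - i"
      using minimal_chain[OF x(1)] by blast
    have N: "0 < ?N"
    proof (rule ccontr)
      assume "\<not> 0 < ?N"
      then have "x \<in> fat \<Omega> s" using g(1,2) by simp
      then show False using x by (simp add: fat_def)
    qed
    have in\<Omega>: "g i \<in> \<Omega>" if "i \<le> ?N" for i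
    proof (cases "i = ?N")
      case True
      then show ?thesis using g(2) sub by auto
    next
      case False
      then show ?thesis using link_bd(1)[OF g(3)[of i]] bd_pos_in that by auto
    qed
    have below: "bd \<Omega> (g i) < s" if "i < ?N" for i
    proof (rule ccontr)
      assume "\<not> bd \<Omega> (g i) < s"
      then have "g i \<in> fat \<Omega> s" using in\<Omega>[of i] that by (simp add: fat_def)
      then have "hops \<Omega> (fat \<Omega> s) (g i) = 0" by (rule hops_eq_0)
      then show False using g(4)[of i] that by simp
    qed
    have above: "s \<le> bd \<Omega> (g ?N)" using g(2) by (simp add: fat_def)
    \<comment> \<open>Along a shortest chain the chain lengths of two vertices differ by exactly the
      number of links between them.\<close>
    have log: "v - u \<le> c * (k + 1)"
      if "u \<le> v" "v \<le> ?N" "dist (g u) (g v) \<le> 2 ^ k * min (bd \<Omega> (g u)) (bd \<Omega> (g v))" for u v k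
    proof -
      have "hops \<Omega> (fat \<Omega> s) (g u) \<le> hops \<Omega> (fat \<Omega> s) (g v) + c * (k + 1)"
        using that s sub dom fat_borel in\<Omega> by (intro hops[of s]) auto
      then have "?N - u \<le> ?N - v + c * (k + 1)" using g(4)[of u] g(4)[of v] that by simp
      then show ?thesis using that by linarith
    qed
    have car: "(\<Sum>j\<le>i. dist (g j) (g (Suc j))) \<le> K * bd \<Omega> (g i)" if "i < ?N" for i
      by (rule carrot[where N = ?N and s = s, OF g(3) log below above that])
    \<comment> \<open>The last vertex before the target still has boundary distance below
      \<open>s\<close>: one link at most doubles it, and the carrot bound there covers the whole
      chain.\<close>
    obtain m where m: "?N = Suc m" using N by (cases ?N) auto
    have "bd \<Omega> (g m) < s" "bd \<Omega> (g ?N) \<le> 2 * bd \<Omega> (g m)"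
      using below[of m] link_bd(5)[OF g(3)[of m]] by (auto simp: m)
    moreover have "(\<Sum>j<?N. dist (g j) (g (Suc j))) \<le> K * bd \<Omega> (g m)"
      using car[of m] by (simp add: m lessThan_Suc_atMost)
    moreover have "K * bd \<Omega> (g m) \<le> K * s"
      using K \<open>bd \<Omega> (g m) < s\<close> by (intro mult_left_mono) auto
    ultimately show ?thesis
      using g(1,3) N car above in\<Omega>[of ?N] by (intro exI[of _ g] exI[of _ ?N]) auto
  qed
  \<comment> \<open>The end points of the two carrots will be at most \<open>(2 * K + 1) * s\<close>
    apart.\<close>
  obtain k :: nat where k: "2 * K + 1 \<le> 2 ^ k"
    using real_arch_pow[of 2 "2 * K + 1"] by (auto intro: less_imp_le)
  define m where "m = c * (k + 1)"
  have middle: "\<exists>h M. h 0 = x' \<and> h M = y' \<and> (\<forall>i<M. (h i, h (Suc i)) \<in> link \<Omega>) \<and>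
      (\<forall>i<M. s / 2 ^ m \<le> bd \<Omega> (h i)) \<and>
      (\<Sum>j<M. dist (h j) (h (Suc j))) \<le> real m * 2 ^ m * s"
    if xy: "x' \<in> \<Omega>" "y' \<in> \<Omega>" "s \<le> bd \<Omega> x'" "s \<le> bd \<Omega> y'" "bd \<Omega> x' \<le> 2 * s"
      "dist x' y' \<le> 2 ^ k * s" and s: "0 < s" "2 * (2 ^ (m + 2) * s) \<le> lam" for x' y' s
  proof -
    \<comment> \<open>\<open>m\<close> links from \<open>x'\<close> raise the boundary distance to
      at most \<open>2 ^ (m + 1) * s\<close>, too little for the fat set. A shortest chain to
      \<open>S\<close> therefore ends at \<open>y'\<close>, while \<open>S\<close> still contains a
      fat set as \<open>hops\<close> requires.\<close>
    define S where "S = insert y' (fat \<Omega> (2 ^ (m + 2) * s))"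
    have S: "fat \<Omega> (2 ^ (m + 2) * s) \<subseteq> S" "S \<subseteq> \<Omega>" "S \<noteq> {}" "S \<in> sets borel"
      using xy fat_borel[OF dom(1)] by (auto simp: S_def fat_def)
    interpret chain_target \<Omega> S
      using dom S by unfold_locales
    let ?M = "hops \<Omega> S x'"
    obtain h where h: "h 0 = x'" "h ?M \<in> S"
      "\<And>i. i < ?M \<Longrightarrow> (h i, h (Suc i)) \<in> link \<Omega>"
      using minimal_chain[OF xy(1)] by blast
    have "dist x' y' \<le> 2 ^ k * min (bd \<Omega> x') (bd \<Omega> y')"
      using xy by (intro order_trans[OF xy(6)] mult_left_mono) auto
    then have "?M \<le> hops \<Omega> S y' + c * (k + 1)" using xy s S by (intro hops[of "2 ^ (m + 2) * s"]) auto
    moreover have "hops \<Omega> S y' = 0" by (rule hops_eq_0) (simp add: S_def)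
    ultimately have M: "?M \<le> m" by (simp add: m_def)
    have bdx: "0 < bd \<Omega> x'" using s xy by linarith
    have up: "bd \<Omega> (h i) \<le> 2 ^ (m + 1) * s" if "i \<le> ?M" for i
    proof -
      have "bd \<Omega> (h i) \<le> 2 ^ (i - 0) * bd \<Omega> (h 0)"
        using h(3) that by (intro bd_chain_le(1)[where N = ?M and g = h]) auto
      also have "\<dots> \<le> 2 ^ m * (2 * s)"
        using that M xy bdx unfolding h(1) by (intro mult_mono power_increasing) auto
      finally show ?thesis by simp
    qed
    have low: "s / 2 ^ m \<le> bd \<Omega> (h i)" if "i \<le> ?M" for i
    proof -
      have "s \<le> bd \<Omega> (h 0)" using xy h by simp
      also have "\<dots> \<le> 2 ^ (i - 0) * bd \<Omega> (h i)"
        using h(3) that by (intro bd_chain_le(2)[where N = ?M and g = h]) auto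
      also have "\<dots> \<le> 2 ^ m * bd \<Omega> (h i)"
        using that M by (intro mult_right_mono power_increasing bd_nonneg) auto
      finally show ?thesis by (simp add: field_simps)
    qed
    have "bd \<Omega> (h ?M) < 2 ^ (m + 2) * s" using up[of ?M] s by (intro le_less_trans[OF up]) simp_all
    then have ends: "h ?M = y'" using h(2) by (auto simp: S_def fat_def)
    have "(\<Sum>j<?M. dist (h j) (h (Suc j))) \<le> (\<Sum>j<?M. 2 ^ m * s)"
    proof (rule sum_mono)
      fix j assume "j \<in> {..<?M}"
      then show "dist (h j) (h (Suc j)) \<le> 2 ^ m * s"
        using link_bd(3)[OF h(3)[of j]] up[of j] by simp
    qed
    also have "\<dots> \<le> real m * (2 ^ m * s)" using M s by (simp add: mult_right_mono)
    finally show ?thesis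
      using h ends low by (intro exI[of _ h] exI[of _ ?M]) (simp add: mult.assoc)
  qed
  obtain z0 where z0: "z0 \<in> \<Omega>" using dom by auto
  then have z0_pos: "0 < bd \<Omega> z0" using bd_pos dom by blast
  \<comment> \<open>The first term makes the larger scale \<open>2 ^ (m + 2) * s\<close> with
    \<open>s = 4 * dist x y\<close> admissible for \<open>lam\<close>; the second puts
    \<open>z0\<close> into \<open>fat \<Omega> s\<close>.\<close>
  define \<delta> where "\<delta> = min (lam / 2 ^ (m + 5)) (bd \<Omega> z0 / 4)"
  \<comment> \<open>Two carrots of length at most \<open>K * s\<close> and a middle chain of length
    at most \<open>m * 2 ^ m * s\<close>, where \<open>s = 4 * dist x y\<close>.\<close>
  define a where "a = 8 * K + 4 * real m * 2 ^ m"
  \<comment> \<open>The second term compares the total length with the smallest boundary distance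
    \<open>s / 2 ^ m\<close> on the middle chain.\<close>
  define b where "b = 4 * K + a * 2 ^ m"
  have a1: "1 \<le> a" using K by (simp add: a_def add_increasing2)
  have b1: "1 \<le> b" using K a1 by (simp add: b_def add_increasing2)
  show ?thesis
    unfolding locally_uniform_def
  proof (rule exI[of _ a], rule exI[of _ b], rule exI[of _ \<delta>], intro conjI ballI impI)
    show "1 \<le> a" "1 \<le> b" by (fact a1, fact b1)
    show "0 < \<delta>" using lam z0_pos by (simp add: \<delta>_def)
  next
    fix x y assume x: "x \<in> \<Omega>" and y: "y \<in> \<Omega>" and xy: "dist x y < \<delta>"
    let ?r = "dist x y"
    show "\<exists>\<gamma>. rectifiable \<gamma> \<and> path_image \<gamma> \<subseteq> \<Omega> \<and> pathstart \<gamma> = x \<and> pathfinish \<gamma> = y \<and>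
        arclength \<gamma> \<le> ennreal (a * dist x y) \<and>
        (\<forall>u\<in>{0..1}. min (arclength (subpath 0 u \<gamma>)) (arclength (subpath u 1 \<gamma>))
           \<le> ennreal b * bdist \<Omega> (\<gamma> u))"
    \<comment> \<open>If \<open>y\<close> is this close to \<open>x\<close>, the segment suffices.
      Otherwise both boundary distances are below \<open>4 * dist x y\<close>, so both points start
      carrots at that scale.\<close>
    proof (cases "2 * ?r \<le> bd \<Omega> x")
      case True
      define p where "p i = (if i = 0 then x else y)" for i :: nat
      have "\<exists>\<gamma>. rectifiable \<gamma> \<and> path_image \<gamma> \<subseteq> \<Omega> \<and> pathstart \<gamma> = p 0 \<and> pathfinish \<gamma> = p 1 \<and>
          arclength \<gamma> \<le> ennreal (a * dist x y) \<and>
          (\<forall>u\<in>{0..1}. min (arclength (subpath 0 u \<gamma>)) (arclength (subpath u 1 \<gamma>))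
             \<le> ennreal b * bdist \<Omega> (\<gamma> u))"
      proof (rule uniform_curve_of_chain[OF dom(1,3)])
        have "1 * ?r \<le> a * ?r" using a1 by (intro mult_right_mono) auto
        then show "(\<Sum>j<1. dist (p j) (p (Suc j))) \<le> a * dist x y" by (simp add: p_def)
        have "1 * bd \<Omega> x \<le> b * bd \<Omega> x" using b1 by (intro mult_right_mono bd_nonneg)
        then show "min (\<Sum>j\<le>i. dist (p j) (p (Suc j))) (\<Sum>j=i..<1. dist (p j) (p (Suc j)))
            \<le> b / 2 * bd \<Omega> (p i)" if "i < 1" for i
          using that True by (simp add: p_def)
      qed (use b1 x True in \<open>auto simp: p_def\<close>)
      then show ?thesis by (simp add: p_def)
    next
      case False
      then have r: "0 < ?r" using bd_nonneg[of \<Omega> x] by linarith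
      define s where "s = 4 * ?r"
      have s: "0 < s" using r by (simp add: s_def)
      have sl: "2 * (2 ^ (m + 2) * s) \<le> lam"
      proof -
        have "?r \<le> lam / 2 ^ (m + 5)" using xy by (simp add: \<delta>_def)
        then have "2 ^ (m + 5) * ?r \<le> lam" by (simp add: field_simps)
        then show ?thesis by (simp add: s_def power_add)
      qed
      have "2 * s \<le> 2 * (2 ^ (m + 2) * s)" using s one_le_power[of "2::real" "m + 2"] by simp
      then have s2: "2 * s \<le> lam" using sl by linarith
      have "z0 \<in> fat \<Omega> s" using xy z0 by (simp add: fat_def s_def \<delta>_def)
      then have fat: "fat \<Omega> s \<noteq> {}" by blast
      have bdx: "bd \<Omega> x < s" and bdy: "bd \<Omega> y < s"
        using False r bd_lipschitz[of \<Omega> x y] by (auto simp: s_def)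
      obtain g N where g: "g 0 = x" "0 < N" "\<And>i. i < N \<Longrightarrow> (g i, g (Suc i)) \<in> link \<Omega>"
        "\<And>i. i < N \<Longrightarrow> (\<Sum>j\<le>i. dist (g j) (g (Suc j))) \<le> K * bd \<Omega> (g i)"
        "s \<le> bd \<Omega> (g N)" "bd \<Omega> (g N) \<le> 2 * s" "g N \<in> \<Omega>"
        "(\<Sum>j<N. dist (g j) (g (Suc j))) \<le> K * s"
        using to_fat[OF x bdx s2 fat] by blast
      obtain g' N' where g': "g' 0 = y" "0 < N'" "\<And>i. i < N' \<Longrightarrow> (g' i, g' (Suc i)) \<in> link \<Omega>"
        "\<And>i. i < N' \<Longrightarrow> (\<Sum>j\<le>i. dist (g' j) (g' (Suc j))) \<le> K * bd \<Omega> (g' i)"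
        "s \<le> bd \<Omega> (g' N')" "bd \<Omega> (g' N') \<le> 2 * s" "g' N' \<in> \<Omega>"
        "(\<Sum>j<N'. dist (g' j) (g' (Suc j))) \<le> K * s"
        using to_fat[OF y bdy s2 fat] by blast
      have "dist (g N) (g' N') \<le> 2 ^ k * s"
      proof -
        have "dist x (g N) \<le> K * s" "dist y (g' N') \<le> K * s"
          using dist_chain_le[of 0 N g] dist_chain_le[of 0 N' g'] g(1,8) g'(1,8)
          by (auto simp: lessThan_atLeast0)
        then have "dist (g N) (g' N') \<le> K * s + ?r + K * s"
          using dist_triangle[of "g N" "g' N'" x] dist_triangle[of x "g' N'" y]
          by (simp add: dist_commute)
        also have "\<dots> \<le> (2 * K + 1) * s" using r by (simp add: s_def algebra_simps)
        also have "\<dots> \<le> 2 ^ k * s" using k s by (intro mult_right_mono) auto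
        finally show ?thesis .
      qed
      then obtain h M where h: "h 0 = g N" "h M = g' N'" "\<And>i. i < M \<Longrightarrow> (h i, h (Suc i)) \<in> link \<Omega>"
        "\<And>i. i < M \<Longrightarrow> s / 2 ^ m \<le> bd \<Omega> (h i)"
        "(\<Sum>j<M. dist (h j) (h (Suc j))) \<le> real m * 2 ^ m * s"
        using middle[OF g(7) g'(7) g(5) g'(5) g(6) _ s sl] by blast
      have "\<exists>\<gamma>. rectifiable \<gamma> \<and> path_image \<gamma> \<subseteq> \<Omega> \<and> pathstart \<gamma> = g 0 \<and> pathfinish \<gamma> = g' 0 \<and>
          arclength \<gamma> \<le> ennreal (a * dist x y) \<and>
          (\<forall>u\<in>{0..1}. min (arclength (subpath 0 u \<gamma>)) (arclength (subpath u 1 \<gamma>))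
             \<le> ennreal b * bdist \<Omega> (\<gamma> u))"
      proof (rule uniform_curve_of_carrots[OF dom(1,3) _ _ g(3,4) h(3,4) g'(3,4) h(1)[symmetric] h(2) g(2)])
        show "0 \<le> K" using K by simp
        show "0 < s / 2 ^ m" using s by simp
        show "(\<Sum>j<N. dist (g j) (g (Suc j))) + (\<Sum>j<M. dist (h j) (h (Suc j)))
            + (\<Sum>j<N'. dist (g' j) (g' (Suc j))) \<le> a * dist x y"
          using g(8) h(5) g'(8) by (simp add: a_def s_def algebra_simps)
        show "4 * K \<le> b" using a1 by (simp add: b_def)
        have "2 * (a * ?r) \<le> a * s" using a1 r by (simp add: s_def)
        also have "\<dots> = a * 2 ^ m * (s / 2 ^ m)" by simp
        also have "\<dots> \<le> b * (s / 2 ^ m)"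
          using K s by (intro mult_right_mono) (auto simp: b_def)
        finally show "2 * (a * dist x y) \<le> b * (s / 2 ^ m)" .
      qed
      then show ?thesis using g(1) g'(1) by simp
    qed
  qed
qed

theorem theorem3p1:
  fixes \<Omega> :: "(real ^ 'n) set" and lam C :: real
  assumes "is_domain \<Omega>"
    and "0 < lam" and "0 < C"
    and "\<forall>f \<in> bmo lam \<Omega>. \<exists>F \<in> BMO.
           (\<forall>x\<in>\<Omega>. F x = f x) \<and> BMO_norm F \<le> ennreal C * bmo_norm lam \<Omega> f"
  shows "locally_uniform \<Omega>"
proof (cases "\<Omega> = UNIV")
  case True
  then show ?thesis by (simp add: locally_uniform_UNIV)
next
  case False
  then have dom: "open \<Omega>" "connected \<Omega>" "\<Omega> \<noteq> UNIV" "\<Omega> \<noteq> {}"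
    using assms(1) by (auto simp: is_domain_def)
  show ?thesis
    by (rule hops_diff_le_of_extension[OF dom(1-3) assms(3,4)],
        rule locally_uniform_of_hops_bound[OF dom assms(2)])
qed

end
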